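(* Let $X$ be a standard Borel space and let $\rho : X \times X \to [0,+\infty]$ be a Borel proper extended metric on $X$. If the Borel asymptotic dimension $\mathrm{asdim}_{\mathbf{B}}(X,\rho)$ is finite, then $\mathrm{asdim}_{\mathbf{B}}(X,\rho) = \mathrm{asdim}(X,\rho)$, where $\mathrm{asdim}(X,\rho)$ is the standard asymptotic dimension of $(X,\rho)$.
   Context: An extended metric is a metric allowed to take the value $+\infty$. It is proper if every ball of finite radius has finite cardinality. Balls $B(x;r)$ are closed balls. Put $E_\rho = \{(x,y) \in X\times X : \rho(x,y) < \infty\}$; if $\rho$ is proper then every $E_\rho$-class is countable. An equivalence relation $E$ on $X$ is uniformly bounded if there is a finite uniform bound on the $\rho$-diameters of its classes. Borel asymptotic dimension: when every $E_\rho$-class is countable, $\mathrm{asdim}_{\mathbf{B}}(X,\rho)$ is the least $d \in \mathbb{N}$ such that for every $r>0$ there is a uniformly bounded Borel equivalence relation $E$ on $X$ such that for every $x\in X$ the ball $B(x;r)$ meets at most $d+1$ classes of $E$; it is $\infty$ if no such $d$ exists. The standard asymptotic dimension $\mathrm{asdim}(X,\rho)$ is defined in the same way but without requiring $E$ to be Borel. *)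

theory Defs
  imports "HOL-Analysis.Analysis" "HOL-Library.Extended_Nat"
begin

definition standard_borel_space :: "'a measure \<Rightarrow> bool" where
  "standard_borel_space M \<longleftrightarrow>
     (\<exists>T. topspace T = space M \<and> completely_metrizable_space T \<and> separable_space T \<and>
          sets M = sigma_sets (space M) {U. openin T U})"

text \<open>Values of \<open>\<rho>\<close> off the carrier \<open>X\<close> are irrelevant throughout.\<close>

definition extended_metric_on :: "'a set \<Rightarrow> ('a \<Rightarrow> 'a \<Rightarrow> ennreal) \<Rightarrow> bool" where
  "extended_metric_on X \<rho> \<longleftrightarrow>
     (\<forall>x\<in>X. \<forall>y\<in>X. \<rho> x y = 0 \<longleftrightarrow> x = y) \<and>
     (\<forall>x\<in>X. \<forall>y\<in>X. \<rho> x y = \<rho> y x) \<and>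
     (\<forall>x\<in>X. \<forall>y\<in>X. \<forall>z\<in>X. \<rho> x z \<le> \<rho> x y + \<rho> y z)"

definition ext_cball :: "'a set \<Rightarrow> ('a \<Rightarrow> 'a \<Rightarrow> ennreal) \<Rightarrow> 'a \<Rightarrow> ennreal \<Rightarrow> 'a set" where
  "ext_cball X \<rho> x r = {y \<in> X. \<rho> x y \<le> r}"

definition proper_on :: "'a set \<Rightarrow> ('a \<Rightarrow> 'a \<Rightarrow> ennreal) \<Rightarrow> bool" where
  "proper_on X \<rho> \<longleftrightarrow> (\<forall>x\<in>X. \<forall>r<\<infinity>. finite (ext_cball X \<rho> x r))"

definition ext_diameter :: "('a \<Rightarrow> 'a \<Rightarrow> ennreal) \<Rightarrow> 'a set \<Rightarrow> ennreal" where
  "ext_diameter \<rho> C = (SUP x\<in>C. SUP y\<in>C. \<rho> x y)"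

definition uniformly_bounded_on ::
    "'a set \<Rightarrow> ('a \<Rightarrow> 'a \<Rightarrow> ennreal) \<Rightarrow> ('a \<times> 'a) set \<Rightarrow> bool" where
  "uniformly_bounded_on X \<rho> E \<longleftrightarrow> (\<exists>D<\<infinity>. \<forall>C \<in> X // E. ext_diameter \<rho> C \<le> D)"

definition ball_meets_at_most ::
    "'a set \<Rightarrow> ('a \<Rightarrow> 'a \<Rightarrow> ennreal) \<Rightarrow> ('a \<times> 'a) set \<Rightarrow> ennreal \<Rightarrow> nat \<Rightarrow> bool" where
  "ball_meets_at_most X \<rho> E r n \<longleftrightarrow>
     (\<forall>x\<in>X. finite {C \<in> X // E. C \<inter> ext_cball X \<rho> x r \<noteq> {}} \<and>
            card {C \<in> X // E. C \<inter> ext_cball X \<rho> x r \<noteq> {}} \<le> n)"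

text \<open>In both dimensions the infimum in \<^typ>\<open>enat\<close> is the least admissible \<open>d\<close>, and
  \<open>\<infinity>\<close> if there is none.\<close>

definition asdim :: "'a set \<Rightarrow> ('a \<Rightarrow> 'a \<Rightarrow> ennreal) \<Rightarrow> enat" where
  "asdim X \<rho> = Inf {enat d | d.
     \<forall>r. 0 < r \<and> r < \<infinity> \<longrightarrow>
       (\<exists>E. equiv X E \<and> uniformly_bounded_on X \<rho> E \<and> ball_meets_at_most X \<rho> E r (d + 1))}"

text \<open>The Borel asymptotic dimension is meaningful when all classes of \<open>fin_dist_rel\<close> are
  countable; for proper \<open>\<rho>\<close> this is automatic, see \<open>proper_on_imp_countable_classes\<close>.\<close>

definition borel_asdim :: "'a measure \<Rightarrow> ('a \<Rightarrow> 'a \<Rightarrow> ennreal) \<Rightarrow> enat" where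
  "borel_asdim M \<rho> = Inf {enat d | d.
     \<forall>r. 0 < r \<and> r < \<infinity> \<longrightarrow>
       (\<exists>E. equiv (space M) E \<and> E \<in> sets (M \<Otimes>\<^sub>M M) \<and>
            uniformly_bounded_on (space M) \<rho> E \<and> ball_meets_at_most (space M) \<rho> E r (d + 1))}"

definition fin_dist_rel :: "'a set \<Rightarrow> ('a \<Rightarrow> 'a \<Rightarrow> ennreal) \<Rightarrow> ('a \<times> 'a) set" where
  "fin_dist_rel X \<rho> = {(x, y). x \<in> X \<and> y \<in> X \<and> \<rho> x y < \<infinity>}"

lemma proper_on_imp_countable_classes:
  assumes "proper_on X \<rho>" and "C \<in> X // fin_dist_rel X \<rho>"
  shows "countable C"
proof -
  obtain x where x: "x \<in> X" and C: "C = fin_dist_rel X \<rho> `` {x}"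
    using assms(2) by (auto elim: quotientE)
  have "C \<subseteq> (\<Union>n::nat. ext_cball X \<rho> x (of_nat n))"
  proof
    fix y assume "y \<in> C"
    then have y: "y \<in> X" "\<rho> x y < \<infinity>" by (auto simp: C fin_dist_rel_def)
    then obtain n :: nat where "\<rho> x y < of_nat n"
      using ennreal_Ex_less_of_nat[of "\<rho> x y"] by auto
    then have "\<rho> x y \<le> of_nat n" by simp
    then show "y \<in> (\<Union>n::nat. ext_cball X \<rho> x (of_nat n))"
      using y by (auto simp: ext_cball_def)
  qed
  moreover have "finite (ext_cball X \<rho> x (of_nat n))" for n
    using assms(1) x by (auto simp: proper_on_def of_nat_less_top)
  ultimately show ?thesis
    by (meson countable_UN countable_finite countable_subset countableI_type)
qed

end

theory Submission
  imports Defs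
begin

text \<open>By Lusin--Novikov uniformization, here needed only for finite sections and derived from Novikov's
  separation theorem for analytic sets, quantifiers over a \<open>\<rho>\<close>-ball are countable and preserve Borel
  sets. Finite Borel asymptotic dimension \<open>m\<close> covers \<open>X\<close>, at every scale \<open>R\<close>, by \<open>m + 1\<close> Borel sets
  whose \<open>R\<close>-components are bounded, hence finite. On a finite component a \<open>(d + 1)\<close>-colouring with bounded
  monochromatic \<open>s\<close>-components, which exists because \<open>asdim = d\<close>, can be chosen in a Borel way among
  countably many candidates. The union argument for asymptotic dimension glues these \<open>m + 1\<close> colourings,
  at rapidly increasing scales, to one Borel \<open>(d + 1)\<close>-colouring of \<open>X\<close>, and its monochromatic components
  are the classes of the required equivalence relation.\<close>

section \<open>Analytic sets and Novikov separation\<close>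

text \<open>The witness for \<open>asdim\<close> need not be Borel, but on a finite set it agrees
  with one of countably many Borel candidates; this is why bounded components are wanted. What makes
  the gluing close up is the order of choices. A colouring of a later set must work at a scale
  exceeding the diameters produced by the earlier ones, so all scales, and with them
  \<open>R\<close>, have to be fixed before the cover is chosen. Two facts allow this: the number
  \<open>m + 1\<close> of sets is the same for every \<open>R\<close>, and the Borel colouring of a
  set inherits the bound \<open>D\<close> of the arbitrary colouring, however large the diameters of
  its \<open>R\<close>-components are. The passage between balls meeting at most
  \<open>d + 1\<close> classes and \<open>d + 1\<close> colours costs only scale: a factor
  \<open>d + 2\<close> in one direction, since balls grow in \<open>d + 1\<close> steps of length
  \<open>r\<close> from radius \<open>r\<close>, and a factor 2 in the other, since two points of a
  ball of radius \<open>r\<close> are at distance at most \<open>2 * r\<close>.\<close>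

definition analytic :: "(nat \<Rightarrow> nat) set \<Rightarrow> bool" where
  "analytic A \<longleftrightarrow> (\<exists>f (F :: (nat \<Rightarrow> nat) set). closed F \<and> continuous_on F f \<and> A = f ` F)"

lemma analytic_continuous_image:
  fixes f :: "(nat \<Rightarrow> nat) \<Rightarrow> nat \<Rightarrow> nat"
  assumes "analytic A" "continuous_on A f"
  shows "analytic (f ` A)"
proof -
  obtain g and F :: "(nat \<Rightarrow> nat) set" where g: "closed F" "continuous_on F g" "A = g ` F"
    using assms(1) unfolding analytic_def by blast
  have "continuous_on F (f \<circ> g)" using g assms(2) by (intro continuous_on_compose) auto
  then show ?thesis unfolding analytic_def using g by (auto simp: image_comp intro!: exI[of _ "f \<circ> g"] exI[of _ F])
qed

lemma continuous_on_reindex: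
  "continuous_on S (\<lambda>w :: 'i \<Rightarrow> 'a::topological_space. (\<lambda>i. w (s i)))"
  by (intro continuous_on_coordinatewise_then_product) (auto intro: continuous_on_subset[OF continuous_on_product_coordinates])

text \<open>The digit \<open>w 0\<close> selects one of the sets, and the tail \<open>sh w\<close>
  is a code for a point of it.\<close>

lemma analytic_UN:
  fixes A :: "nat \<Rightarrow> (nat \<Rightarrow> nat) set"
  assumes "\<And>n. analytic (A n)"
  shows "analytic (\<Union>n. A n)"
proof -
  have "\<forall>n. \<exists>f (F :: (nat \<Rightarrow> nat) set). closed F \<and> continuous_on F f \<and> A n = f ` F"
    using assms unfolding analytic_def by blast
  then obtain f and F :: "nat \<Rightarrow> (nat \<Rightarrow> nat) set" where
    F: "\<And>n. closed (F n)" "\<And>n. continuous_on (F n) (f n)" "\<And>n. A n = f n ` F n"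
    by metis
  define sh :: "(nat \<Rightarrow> nat) \<Rightarrow> (nat \<Rightarrow> nat)" where "sh = (\<lambda>w i. w (Suc i))"
  have csh: "continuous_on S sh" for S unfolding sh_def by (rule continuous_on_reindex)
  define G where "G = {w. sh w \<in> F (w 0)}"
  have c0: "continuous_on UNIV (\<lambda>w :: nat \<Rightarrow> nat. w 0)" by simp
  have op: "open {w :: nat \<Rightarrow> nat. w 0 \<in> S}" for S
    using open_vimage[OF open_discrete[of S] c0] by (simp add: vimage_def)
  have cl: "closed {w :: nat \<Rightarrow> nat. w 0 \<noteq> n}" for n
    using op[of "{n}"] by (simp add: closed_def Compl_eq)
  have "G = (\<Inter>n. {w. w 0 \<noteq> n} \<union> sh -` F n)" unfolding G_def by auto
  moreover have "closed (\<Inter>n. {w. w 0 \<noteq> n} \<union> sh -` F n)"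
    by (intro closed_INT ballI closed_Un cl closed_vimage[OF F(1) csh])
  ultimately have "closed G" by simp
  moreover have "continuous_on G (\<lambda>w. f (w 0) (sh w))"
    unfolding continuous_on_def
  proof
    fix w assume w: "w \<in> G"
    \<comment> \<open>\<open>?T\<close> is an open neighbourhood of \<open>w\<close> on which the
      selected index is constant, so continuity at \<open>w\<close> is that of a single
      \<open>f n\<close>.\<close>
    let ?T = "{v :: nat \<Rightarrow> nat. v 0 \<in> {w 0}}"
    have "continuous_on (G \<inter> ?T) (\<lambda>v. f (w 0) (sh v))"
      by (rule continuous_on_compose2[OF F(2)[of "w 0"] csh]) (auto simp: G_def)
    then have "continuous_on (G \<inter> ?T) (\<lambda>v. f (v 0) (sh v))"
      by (rule continuous_on_eq) auto
    then have "((\<lambda>v. f (v 0) (sh v)) \<longlongrightarrow> f (w 0) (sh w)) (at w within G \<inter> ?T)"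
      using w by (auto simp: continuous_on_def)
    moreover have "at w within G \<inter> ?T = at w within G"
      by (rule at_within_nhd[of _ ?T]) (use op[of "{w 0}"] in auto)
    ultimately show "((\<lambda>v. f (v 0) (sh v)) \<longlongrightarrow> f (w 0) (sh w)) (at w within G)" by simp
  qed
  moreover have "(\<Union>n. A n) = (\<lambda>w. f (w 0) (sh w)) ` G"
  proof (intro equalityI subsetI)
    fix x assume "x \<in> (\<Union>n. A n)"
    then obtain n z where z: "z \<in> F n" "x = f n z" using F(3) by auto
    have "sh (case_nat n z) = z" by (auto simp: sh_def)
    then show "x \<in> (\<lambda>w. f (w 0) (sh w)) ` G"
      using z by (intro image_eqI[of _ _ "case_nat n z"]) (auto simp: G_def)
  next
    fix x assume "x \<in> (\<lambda>w. f (w 0) (sh w)) ` G"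
    then show "x \<in> (\<Union>n. A n)" using F(3) by (auto simp: G_def)
  qed
  ultimately show ?thesis unfolding analytic_def by blast
qed

text \<open>One code \<open>w\<close> holds a whole sequence of codes \<open>sl n w\<close>, and
  \<open>G\<close> keeps those whose values all agree. Closed domains in \<open>analytic\<close> pay
  off here: \<open>G\<close> is closed, and no retraction of Baire space onto it has to be
  found.\<close>

lemma analytic_INT:
  fixes A :: "nat \<Rightarrow> (nat \<Rightarrow> nat) set"
  assumes "\<And>n. analytic (A n)"
  shows "analytic (\<Inter>n. A n)"
proof -
  have "\<forall>n. \<exists>f (F :: (nat \<Rightarrow> nat) set). closed F \<and> continuous_on F f \<and> A n = f ` F"
    using assms unfolding analytic_def by blast
  then obtain f and F :: "nat \<Rightarrow> (nat \<Rightarrow> nat) set" where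
    F: "\<And>n. closed (F n)" "\<And>n. continuous_on (F n) (f n)" "\<And>n. A n = f n ` F n"
    by metis
  define sl :: "nat \<Rightarrow> (nat \<Rightarrow> nat) \<Rightarrow> (nat \<Rightarrow> nat)" where "sl = (\<lambda>n w i. w (prod_encode (n, i)))"
  have csl: "continuous_on S (sl n)" for S n unfolding sl_def by (rule continuous_on_reindex)
  define H where "H = (\<Inter>n. sl n -` F n)"
  have clH: "closed H" unfolding H_def by (intro closed_INT ballI closed_vimage[OF F(1) csl])
  have cf: "continuous_on H (\<lambda>w. f n (sl n w))" for n
    by (rule continuous_on_compose2[OF F(2)[of n] csl]) (auto simp: H_def)
  \<comment> \<open>Agreement is tested digit by digit against the value at index 0; each test is a
    closed condition on \<open>H\<close>.\<close>
  define G where "G = (\<Inter>n i. H \<inter> (\<lambda>w. (f n (sl n w) i, f 0 (sl 0 w) i)) -` {y. \<exists>x. y = (x, x)})"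
  have "closed G" unfolding G_def
    by (intro closed_INT ballI continuous_closed_preimage continuous_on_Pair clH closed_diagonal
        continuous_on_product_then_coordinatewise[OF cf])
  moreover have GH: "G \<subseteq> H" unfolding G_def by auto
  moreover have "(\<Inter>n. A n) = (\<lambda>w. f 0 (sl 0 w)) ` G"
  proof (intro equalityI subsetI)
    fix x assume "x \<in> (\<Inter>n. A n)"
    then have "\<forall>n. \<exists>z. z \<in> F n \<and> x = f n z" using F(3) by auto
    then obtain z where z: "\<And>n. z n \<in> F n" "\<And>n. x = f n (z n)" by metis
    define w where "w = (\<lambda>k. case prod_decode k of (n, i) \<Rightarrow> z n i)"
    have "sl n w = z n" for n by (auto simp: sl_def w_def)
    then show "x \<in> (\<lambda>w. f 0 (sl 0 w)) ` G"
      using z by (intro image_eqI[of _ _ w]) (auto simp: G_def H_def)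
  next
    fix x assume "x \<in> (\<lambda>w. f 0 (sl 0 w)) ` G"
    then obtain w where w: "w \<in> G" "x = f 0 (sl 0 w)" by auto
    have "x = f n (sl n w)" "sl n w \<in> F n" for n
      using w unfolding G_def H_def by (auto simp: fun_eq_iff)
    then show "x \<in> (\<Inter>n. A n)" using F(3) by auto
  qed
  ultimately show ?thesis unfolding analytic_def
    using continuous_on_subset[OF cf GH] by blast
qed

lemma closed_analytic:
  assumes "closed (C :: (nat \<Rightarrow> nat) set)" shows "analytic C"
  unfolding analytic_def using assms continuous_on_id by (metis image_ident)

lemma open_baire_contains_cylinder:
  assumes "open (U :: (nat \<Rightarrow> nat) set)" "z \<in> U"
  obtains j where "\<And>w. (\<forall>i<j. w i = z i) \<Longrightarrow> w \<in> U"
proof -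
  have "openin (product_topology (\<lambda>i. euclidean) UNIV) U" using assms(1) by (simp add: open_fun_def)
  from product_topology_open_contains_basis[OF this assms(2)]
  obtain Y where Y: "z \<in> (\<Pi>\<^sub>E i\<in>UNIV. Y i)" "finite {i. Y i \<noteq> topspace euclidean}" "(\<Pi>\<^sub>E i\<in>UNIV. Y i) \<subseteq> U"
    by blast
  obtain j where j: "\<And>i. Y i \<noteq> UNIV \<Longrightarrow> i < j"
    using finite_nat_set_iff_bounded Y(2) by (auto simp: finite_nat_set_iff_bounded)
  have "w \<in> U" if "\<forall>i<j. w i = z i" for w
  proof -
    have "w i \<in> Y i" for i using j[of i] that PiE_mem[OF Y(1), of i] by (cases "Y i = UNIV") auto
    then show ?thesis using Y(3) by auto
  qed
  then show ?thesis using that by blast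
qed

text \<open>Cylinders are indexed by the countably many finite lists. They are closed, and an open
  set is the union of those it contains.\<close>

lemma open_analytic:
  assumes "open (U :: (nat \<Rightarrow> nat) set)" shows "analytic U"
proof -
  define cyl :: "nat list \<Rightarrow> (nat \<Rightarrow> nat) set" where "cyl = (\<lambda>s. \<Inter>i\<in>{..<length s}. (\<lambda>w. w i) -` {s ! i})"
  have "closed (cyl s)" for s unfolding cyl_def
    by (intro closed_INT ballI closed_vimage) auto
  define A where "A = (\<lambda>n. if cyl (from_nat n) \<subseteq> U then cyl (from_nat n) else {})"
  have "analytic (A n)" for n
    using closed_analytic[of "cyl (from_nat n)"] closed_analytic[of "{}"] \<open>\<And>s. closed (cyl s)\<close>
    by (simp add: A_def)
  then have "analytic (\<Union>n. A n)" by (rule analytic_UN)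
  moreover have "(\<Union>n. A n) = U"
  proof (intro equalityI subsetI)
    fix z assume "z \<in> U"
    then obtain j where j: "\<And>w. (\<forall>i<j. w i = z i) \<Longrightarrow> w \<in> U"
      using open_baire_contains_cylinder[OF assms] by blast
    have "z \<in> cyl (map z [0..<j])" "cyl (map z [0..<j]) \<subseteq> U"
      using j by (auto simp: cyl_def)
    then have "z \<in> A (to_nat (map z [0..<j]))" by (simp add: A_def)
    then show "z \<in> (\<Union>n. A n)" by blast
  qed (auto simp: A_def split: if_splits)
  ultimately show ?thesis by simp
qed

text \<open>With \<open>odds\<close> and \<open>interleave\<close> this identifies Baire space with
  its square.\<close>

definition evens :: "(nat \<Rightarrow> 'a) \<Rightarrow> nat \<Rightarrow> 'a" where
  "evens w = (\<lambda>i. w (2 * i))"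

definition odds :: "(nat \<Rightarrow> 'a) \<Rightarrow> nat \<Rightarrow> 'a" where
  "odds w = (\<lambda>i. w (2 * i + 1))"

definition interleave :: "(nat \<Rightarrow> 'a) \<Rightarrow> (nat \<Rightarrow> 'a) \<Rightarrow> nat \<Rightarrow> 'a" where
  "interleave u v = (\<lambda>i. if even i then u (i div 2) else v (i div 2))"

lemma evens_interleave [simp]: "evens (interleave u v) = u"
  and odds_interleave [simp]: "odds (interleave u v) = v"
  by (auto simp: evens_def odds_def interleave_def)

text \<open>Complements of analytic sets need not be analytic, so the induction over the generated
  sigma-algebra carries the claim for \<open>S\<close> and \<open>- S\<close> together.\<close>

lemma analytic_borel:
  fixes S :: "(nat \<Rightarrow> nat) set"
  assumes "S \<in> sets borel"
  shows "analytic S"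
proof -
  have "S \<in> sigma_sets UNIV {S. open S}" using assms by (simp add: borel_def)
  then have "analytic S \<and> analytic (- S)"
  proof induction
    case (Union a)
    then show ?case using analytic_UN[of a] analytic_INT[of "\<lambda>i. - a i"] by auto
  qed (auto simp: Compl_eq_Diff_UNIV intro: open_analytic closed_analytic simp flip: Compl_eq_Diff_UNIV)
  then show ?thesis by simp
qed

lemma analytic_fst_image_borel:
  fixes S :: "((nat \<Rightarrow> nat) \<times> (nat \<Rightarrow> nat)) set"
  assumes "S \<in> sets borel" shows "analytic (fst ` S)"
proof -
  have c: "continuous_on UNIV (\<lambda>w :: nat \<Rightarrow> nat. (evens w, odds w))"
    unfolding evens_def odds_def by (intro continuous_on_Pair continuous_on_reindex)
  have ce: "continuous_on T (evens :: (nat \<Rightarrow> nat) \<Rightarrow> nat \<Rightarrow> nat)" for T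
    unfolding evens_def by (rule continuous_on_reindex)
  have "(\<lambda>w :: nat \<Rightarrow> nat. (evens w, odds w)) -` S \<inter> space borel \<in> sets borel"
    by (rule measurable_sets[OF borel_measurable_continuous_onI[OF c] assms])
  then have "analytic (evens ` ((\<lambda>w. (evens w, odds w)) -` S))"
    by (intro analytic_continuous_image[OF _ ce] analytic_borel) simp
  moreover have "evens ` ((\<lambda>w. (evens w, odds w)) -` S) = fst ` S"
  proof (intro equalityI subsetI)
    fix u assume "u \<in> fst ` S"
    then obtain v where "(u, v) \<in> S" by auto
    then show "u \<in> evens ` ((\<lambda>w. (evens w, odds w)) -` S)"
      by (intro image_eqI[of _ _ "interleave u v"]) auto
  qed force
  ultimately show ?thesis by simp
qed

section \<open>Novikov separation of countably many sets\<close>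

definition borel_separable :: "(nat \<Rightarrow> 'b::topological_space set) \<Rightarrow> bool" where
  "borel_separable A \<longleftrightarrow> (\<exists>B. (\<forall>n. B n \<in> sets borel \<and> A n \<subseteq> B n) \<and> (\<Inter>n. B n) = {})"

lemma borel_separable_mono: "borel_separable A \<Longrightarrow> (\<And>n. A' n \<subseteq> A n) \<Longrightarrow> borel_separable A'"
  unfolding borel_separable_def by (meson order_trans)

text \<open>Read contrapositively: a non-separable sequence stays non-separable when
  \<open>A m\<close> is replaced by a suitable one of countably many pieces. The separators are
  united at index \<open>m\<close> and intersected elsewhere, so a point common to all
  \<open>C n\<close> would lie in every \<open>B k n\<close> for one and the same
  \<open>k\<close>.\<close>

lemma borel_separable_split:
  assumes "A m \<subseteq> (\<Union>k::nat. P k)" and "\<And>k. borel_separable (A(m := P k))"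
  shows "borel_separable A"
proof -
  have "\<forall>k. \<exists>B. (\<forall>n. B n \<in> sets borel \<and> (A(m := P k)) n \<subseteq> B n) \<and> (\<Inter>n. B n) = {}"
    using assms(2) unfolding borel_separable_def by blast
  then obtain B where B: "\<And>k n. B k n \<in> sets borel" "\<And>k n. (A(m := P k)) n \<subseteq> B k n" "\<And>k. (\<Inter>n. B k n) = {}"
    by metis
  define C where "C = (\<lambda>n. if n = m then (\<Union>k. B k m) else (\<Inter>k. B k n))"
  have "C n \<in> sets borel" for n using B(1) by (auto simp: C_def)
  moreover have "A n \<subseteq> C n" for n
  proof (cases "n = m")
    case True
    have "P k \<subseteq> B k m" for k using B(2)[where k=k and n=m] by simp
    then show ?thesis using assms(1) True by (fastforce simp: C_def)
  next
    case False
    then show ?thesis using B(2)[where n=n] by (auto simp: C_def)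
  qed
  moreover have "(\<Inter>n. C n) = {}"
  proof -
    have False if C: "\<And>n. x \<in> C n" for x
    proof -
      obtain k where k: "x \<in> B k m" using C[of m] by (auto simp: C_def)
      have "x \<in> B k n" for n using C[of n] k by (auto simp: C_def split: if_splits)
      then show False using B(3)[of k] by blast
    qed
    then show ?thesis by auto
  qed
  ultimately show ?thesis unfolding borel_separable_def by blast
qed

lemma borel_separable_empty:
  assumes "A m = {}" shows "borel_separable A"
  unfolding borel_separable_def using assms
  by (intro exI[of _ "\<lambda>n. if n = m then {} else UNIV"]) auto

text \<open>Splitting treats one index at a time, so after finitely many rounds only the first
  \<open>M\<close> sets have been refined. This is why the fusion in
  \<open>novikov_separation\<close> lets a new index enter at every stage.\<close>

lemma not_borel_separable_refine:
  fixes P :: "nat \<Rightarrow> 'i::countable \<Rightarrow> 'b::topological_space set"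
  assumes "\<not> borel_separable A" "\<And>m. A m \<subseteq> (\<Union>t. P m t)"
  shows "\<exists>\<kappa>. \<not> borel_separable (\<lambda>n. if n < M then P n (\<kappa> n) else A n)"
proof (induction M)
  case 0
  show ?case using assms(1) by simp
next
  case (Suc M)
  then obtain \<kappa> where k: "\<not> borel_separable (\<lambda>n. if n < M then P n (\<kappa> n) else A n)" by blast
  let ?A = "\<lambda>n. if n < M then P n (\<kappa> n) else A n"
  have "?A M \<subseteq> (\<Union>k::nat. P M (from_nat k))"
  proof
    fix x assume "x \<in> ?A M"
    then obtain t where "x \<in> P M t" using assms(2)[of M] by auto
    then show "x \<in> (\<Union>k::nat. P M (from_nat k))" by (intro UN_I[of "to_nat t"]) auto
  qed
  then obtain k :: nat where "\<not> borel_separable (?A(M := P M (from_nat k)))"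
    using borel_separable_split[of ?A M "\<lambda>k. P M (from_nat k)"] k by blast
  moreover have "?A(M := P M (from_nat k)) =
      (\<lambda>n. if n < Suc M then P n ((\<kappa>(M := from_nat k)) n) else A n)"
    by (auto simp: fun_eq_iff less_Suc_eq)
  ultimately show ?case by metis
qed

text \<open>If separation fails, it keeps failing along ever longer cylinders shrinking to codes
  \<open>\<zeta> n\<close>. As the sets have no common point, two of the values
  \<open>f n (\<zeta> n)\<close> differ, and disjoint open sets around these two already separate a
  late stage.\<close>

theorem novikov_separation:
  fixes A :: "nat \<Rightarrow> (nat \<Rightarrow> nat) set"
  assumes an: "\<And>n. analytic (A n)" and disj: "(\<Inter>n. A n) = {}"
  shows "borel_separable A"
proof (rule ccontr)
  assume nsep: "\<not> borel_separable A"
  have "\<forall>n. \<exists>f (F :: (nat \<Rightarrow> nat) set). closed F \<and> continuous_on F f \<and> A n = f ` F"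
    using an unfolding analytic_def by blast
  then obtain f and F :: "nat \<Rightarrow> (nat \<Rightarrow> nat) set" where
    F: "\<And>n. closed (F n)" "\<And>n. continuous_on (F n) (f n)" "\<And>n. A n = f n ` F n"
    by metis
  define Cyl :: "(nat \<Rightarrow> nat) \<Rightarrow> nat \<Rightarrow> (nat \<Rightarrow> nat) set" where "Cyl = (\<lambda>z j. {w. \<forall>i<j. w i = z i})"
  \<comment> \<open>Stage \<open>j\<close> restricts only the first \<open>j\<close> sets, each to a
    cylinder of length \<open>j\<close>. The prefix is stored as a full point \<open>z n\<close>,
    whose later digits are still free.\<close>
  define piece where "piece = (\<lambda>j z n. f n ` (F n \<inter> (if n < j then Cyl (z n) j else UNIV)))"
  have "\<exists>z. \<forall>j. \<not> borel_separable (piece j (z j)) \<and> (\<forall>n<j. \<forall>i<j. z (Suc j) n i = z j n i)"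
  proof (rule dependent_nat_choice)
    have "piece 0 (\<lambda>_ _. 0) = A" by (auto simp: piece_def F)
    then show "\<exists>z. \<not> borel_separable (piece 0 z)" using nsep by metis
  next
    fix z j assume ns: "\<not> borel_separable (piece j z)"
    define P where "P = (\<lambda>n t. f n ` (F n \<inter> (if n < j then Cyl (z n) j else UNIV) \<inter> {w. map w [0..<Suc j] = t}))"
    have "piece j z m \<subseteq> (\<Union>t. P m t)" for m unfolding piece_def P_def by auto
    from not_borel_separable_refine[OF ns this, of "Suc j"]
    obtain \<kappa> where k: "\<not> borel_separable (\<lambda>n. if n < Suc j then P n (\<kappa> n) else piece j z n)" (is "\<not> borel_separable ?B")
      by blast
    \<comment> \<open>An empty set in the sequence would make it separable. Hence each chosen piece
      contains a point, which serves as the next \<open>z n\<close>.\<close>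
    have "\<exists>w. n < Suc j \<longrightarrow> w \<in> F n \<inter> (if n < j then Cyl (z n) j else UNIV) \<inter> {w. map w [0..<Suc j] = \<kappa> n}" for n
    proof (cases "n < Suc j")
      case True
      then have "P n (\<kappa> n) \<noteq> {}" using borel_separable_empty[of ?B n] k by auto
      then show ?thesis unfolding P_def by blast
    qed auto
    then obtain z' where z': "\<And>n. n < Suc j \<Longrightarrow> z' n \<in> F n \<inter> (if n < j then Cyl (z n) j else UNIV) \<inter> {w. map w [0..<Suc j] = \<kappa> n}"
      by metis
    have "?B n \<subseteq> piece (Suc j) z' n" for n
    proof (cases "n < Suc j")
      case True
      have "w \<in> Cyl (z' n) (Suc j)" if "map w [0..<Suc j] = \<kappa> n" for w
      proof -
        have "map w [0..<Suc j] = map (z' n) [0..<Suc j]" using that z'[OF True] by simp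
        then show ?thesis unfolding Cyl_def map_eq_conv by (simp del: upt_Suc)
      qed
      then show ?thesis using True by (auto simp: P_def piece_def simp del: upt_Suc)
    qed (auto simp: piece_def)
    then have "\<not> borel_separable (piece (Suc j) z')" using k borel_separable_mono[of "piece (Suc j) z'" ?B] by blast
    moreover have "\<forall>n<j. \<forall>i<j. z' n i = z n i"
    proof (intro allI impI)
      fix n i assume "n < j" "i < j"
      then show "z' n i = z n i" using z'[of n] by (simp add: Cyl_def del: upt_Suc)
    qed
    ultimately show "\<exists>z'. \<not> borel_separable (piece (Suc j) z') \<and> (\<forall>n<j. \<forall>i<j. z' n i = z n i)" by blast
  qed
  then obtain z where z: "\<And>j. \<not> borel_separable (piece j (z j))" "\<And>j n i. n < j \<Longrightarrow> i < j \<Longrightarrow> z (Suc j) n i = z j n i"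
    by blast
  \<comment> \<open>Digit \<open>i\<close> of the \<open>n\<close>-th code no longer changes once
    the stage exceeds both \<open>n\<close> and \<open>i\<close>.\<close>
  define \<zeta> where "\<zeta> = (\<lambda>n i. z (Suc (max n i)) n i)"
  have zz: "z j n i = \<zeta> n i" if "n < j" "i < j" for j n i
  proof -
    have "Suc (max n i) \<le> j" using that by auto
    then show ?thesis
      by (induction j rule: dec_induct) (use z(2) in \<open>auto simp: \<zeta>_def\<close>)
  qed
  have ns: "\<not> borel_separable (\<lambda>n. f n ` (F n \<inter> (if n < j then Cyl (\<zeta> n) j else UNIV)))" for j
  proof -
    have "piece j (z j) = (\<lambda>n. f n ` (F n \<inter> (if n < j then Cyl (\<zeta> n) j else UNIV)))"
      unfolding piece_def Cyl_def by (intro ext) (use zz in auto)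
    then show ?thesis using z(1)[of j] by simp
  qed
  \<comment> \<open>A point outside the closed set \<open>F n\<close> has a cylinder missing
    \<open>F n\<close>, which would make the \<open>n\<close>-th piece empty at a late
    stage.\<close>
  have \<zeta>F: "\<zeta> n \<in> F n" for n
  proof (rule ccontr)
    assume "\<zeta> n \<notin> F n"
    then obtain j where j: "\<And>w. (\<forall>i<j. w i = \<zeta> n i) \<Longrightarrow> w \<in> - F n"
      using open_baire_contains_cylinder[of "- F n" "\<zeta> n"] F(1)[of n] by auto
    have "w \<notin> F n" if "w \<in> Cyl (\<zeta> n) (max j (Suc n))" for w
      using j[of w] that by (simp add: Cyl_def)
    then have "F n \<inter> Cyl (\<zeta> n) (max j (Suc n)) = {}" by blast
    then show False using ns[of "max j (Suc n)"]
      borel_separable_empty[of "\<lambda>m. f m ` (F m \<inter> (if m < max j (Suc n) then Cyl (\<zeta> m) (max j (Suc n)) else UNIV))" n]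
      by (simp add: less_max_iff_disj)
  qed
  have cyl: "\<exists>j. \<forall>k\<ge>j. f n ` (F n \<inter> Cyl (\<zeta> n) k) \<subseteq> U" if U: "open U" "f n (\<zeta> n) \<in> U" for n U
  proof -
    obtain W where W: "open W" "\<zeta> n \<in> W" "\<And>w. w \<in> F n \<Longrightarrow> w \<in> W \<Longrightarrow> f n w \<in> U"
      using F(2)[of n, unfolded continuous_on_topological, rule_format, OF \<zeta>F U] by blast
    obtain j where "\<And>w. (\<forall>i<j. w i = \<zeta> n i) \<Longrightarrow> w \<in> W"
      using open_baire_contains_cylinder[OF W(1,2)] by blast
    then have "Cyl (\<zeta> n) k \<subseteq> W" if "k \<ge> j" for k using that by (simp add: Cyl_def subset_iff)
    then show ?thesis using W(3) by (intro exI[of _ j]) blast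
  qed
  have "\<exists>n. f n (\<zeta> n) \<noteq> f 0 (\<zeta> 0)"
  proof (rule ccontr)
    assume "\<not> ?thesis"
    then have "f 0 (\<zeta> 0) \<in> A n" for n using F(3)[of n] \<zeta>F[of n] by (metis imageI)
    then show False using disj by blast
  qed
  then obtain n where n: "f n (\<zeta> n) \<noteq> f 0 (\<zeta> 0)" by blast
  then obtain i where i: "f n (\<zeta> n) i \<noteq> f 0 (\<zeta> 0) i" by auto
  have op: "open {u :: nat \<Rightarrow> nat. u i \<in> S}" for S
    using open_vimage[OF open_discrete[of S] continuous_on_product_coordinates[of i]] by (simp add: vimage_def)
  define U V where "U = {u. u i \<in> {f n (\<zeta> n) i}}" and "V = {u. u i \<in> - {f n (\<zeta> n) i}}"
  have UV: "open U" "open V" "f n (\<zeta> n) \<in> U" "f 0 (\<zeta> 0) \<in> V" "U \<inter> V = {}"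
    using i unfolding U_def V_def by (auto simp only: op)
  obtain j1 where j1: "\<And>k. k \<ge> j1 \<Longrightarrow> f n ` (F n \<inter> Cyl (\<zeta> n) k) \<subseteq> U" using cyl UV by meson
  obtain j2 where j2: "\<And>k. k \<ge> j2 \<Longrightarrow> f 0 ` (F 0 \<inter> Cyl (\<zeta> 0) k) \<subseteq> V" using cyl UV by meson
  define k where "k = Max {j1, j2, Suc n}"
  have k: "k \<ge> j1" "k \<ge> j2" "n < k" by (auto simp: k_def)
  have "n \<noteq> 0" using n by metis
  \<comment> \<open>At stage \<open>k\<close> the pieces of index \<open>n\<close> and 0 lie in the
    disjoint sets \<open>U\<close> and \<open>V\<close>; all other sets may be separated by the
    whole space.\<close>
  define B where "B = (\<lambda>m. if m = n then U else if m = 0 then V else UNIV)"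
  have "B m \<in> sets borel" for m using UV by (auto simp: B_def)
  moreover have "f m ` (F m \<inter> (if m < k then Cyl (\<zeta> m) k else UNIV)) \<subseteq> B m" for m
    using j1[OF k(1)] j2[OF k(2)] k(3) by (auto simp: B_def)
  moreover have "(\<Inter>m. B m) = {}"
  proof -
    have "(\<Inter>m. B m) \<subseteq> B n \<inter> B 0" by blast
    also have "\<dots> = {}" using UV(5) \<open>n \<noteq> 0\<close> by (simp add: B_def)
    finally show ?thesis by blast
  qed
  ultimately show False using ns[of k] unfolding borel_separable_def by blast
qed

section \<open>Uniformization of Borel sets with finite sections\<close>

text \<open>A substitute for a Borel isomorphism with a Borel subset of Baire space. As the decoding
  \<open>L\<close> is total, Borel sets can be moved to codes by preimages, and the range of
  \<open>g\<close> never has to be described.\<close>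

definition baire_retract :: "'a measure \<Rightarrow> ('a \<Rightarrow> nat \<Rightarrow> nat) \<Rightarrow> ((nat \<Rightarrow> nat) \<Rightarrow> 'a) \<Rightarrow> bool" where
  "baire_retract M g L \<longleftrightarrow> g \<in> borel_measurable M \<and> L \<in> borel \<rightarrow>\<^sub>M M \<and> (\<forall>x\<in>space M. L (g x) = x)"

lemma borel_measurable_baireD:
  fixes f :: "'a \<Rightarrow> nat \<Rightarrow> nat"
  assumes "f \<in> borel_measurable M"
  shows "(\<lambda>x. f x k) \<in> M \<rightarrow>\<^sub>M count_space UNIV"
proof -
  have "(\<lambda>u :: nat \<Rightarrow> nat. u k) \<in> borel \<rightarrow>\<^sub>M borel"
    by (rule borel_measurable_continuous_onI) simp
  then have "(\<lambda>u :: nat \<Rightarrow> nat. u k) \<in> borel \<rightarrow>\<^sub>M count_space UNIV"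
    using measurable_cong_sets[OF refl sets_borel_eq_count_space] by blast
  then show ?thesis by (rule measurable_compose[OF assms])
qed

lemma borel_measurable_baire_coordinate:
  "(\<lambda>u :: nat \<Rightarrow> nat. u k) \<in> borel \<rightarrow>\<^sub>M count_space UNIV"
  by (rule borel_measurable_baireD) simp

lemma borel_measurable_baireI:
  fixes f :: "'a \<Rightarrow> nat \<Rightarrow> nat"
  assumes "\<And>k. (\<lambda>x. f x k) \<in> M \<rightarrow>\<^sub>M count_space UNIV"
  shows "f \<in> borel_measurable M"
proof (rule measurable_coordinatewise_then_product)
  show "(\<lambda>x. f x k) \<in> borel_measurable M" for k
    using assms[of k] measurable_cong_sets[OF refl sets_borel_eq_count_space] by blast
qed

text \<open>The code of \<open>x\<close> lists, for each \<open>k\<close>, the first point of a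
  dense sequence within \<open>1 / (k + 1)\<close> of \<open>x\<close>. Decoding takes the limit of
  the listed points.\<close>

lemma standard_borel_space_baire_retract:
  assumes "standard_borel_space M" "space M \<noteq> {}"
  shows "\<exists>g L. baire_retract M g L"
proof -
  obtain T where T: "topspace T = space M" "completely_metrizable_space T" "separable_space T"
      "sets M = sigma_sets (space M) {U. openin T U}"
    using assms(1) unfolding standard_borel_space_def by blast
  obtain S d where Sd: "Metric_space S d" "Metric_space.mcomplete S d" "T = Metric_space.mtopology S d"
    using T(2) unfolding completely_metrizable_space_def by blast
  interpret Metric_space S d by fact
  have S: "space M = S" using T(1) Sd(3) by simp
  obtain C where C: "countable C" "C \<subseteq> S" "mtopology closure_of C = S"
    using T(3) unfolding separable_space_def Sd(3) by auto
  have "C \<noteq> {}" using C(3) assms(2) S by auto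
  define e where "e = from_nat_into C"
  have eS: "e i \<in> S" for i using from_nat_into[OF \<open>C \<noteq> {}\<close>] C(2) by (auto simp: e_def)
  have dense: "\<exists>i. d x (e i) < r" if xr: "x \<in> S" "r > 0" for x r
  proof -
    have "x \<in> mtopology closure_of C" using C(3) xr by simp
    then obtain y where "y \<in> C" "d x y < r" using xr unfolding metric_closure_of by auto
    moreover obtain i where "y = e i" using from_nat_into_surj[OF C(1) \<open>y \<in> C\<close>] by (auto simp: e_def)
    ultimately show ?thesis by auto
  qed
  define g where "g = (\<lambda>x (k::nat). LEAST i. d x (e i) < inverse (of_nat (Suc k)))"
  have md: "(\<lambda>x. d x (e i)) \<in> borel_measurable M" for i
    unfolding borel_measurable_iff_less
  proof
    fix a
    have "{x \<in> space M. d x (e i) < a} = mball (e i) a" unfolding S using eS by (auto simp: commute)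
    moreover have "mball (e i) a \<in> sets M" unfolding T(4) Sd(3) by (auto intro: sigma_sets.Basic)
    ultimately show "{x \<in> space M. d x (e i) < a} \<in> sets M" by simp
  qed
  have g: "g \<in> borel_measurable M"
  proof (rule borel_measurable_baireI)
    note md[measurable]
    show "(\<lambda>x. g x k) \<in> M \<rightarrow>\<^sub>M count_space UNIV" for k
      unfolding g_def by measurable
  qed
  have dg: "d x (e (g x k)) < inverse (of_nat (Suc k))" if "x \<in> S" for x k
    unfolding g_def by (rule LeastI_ex) (rule dense[OF that], simp)
  define K where "K = (\<lambda>u. MCauchy (\<lambda>k. e (u k)))"
  \<comment> \<open>Codes that list no Cauchy sequence go to \<open>e 0\<close>, which keeps
    \<open>L\<close> total.\<close>
  define L where "L = (\<lambda>u. if K u then (SOME l. limitin mtopology (\<lambda>k. e (u k)) l sequentially) else e 0)"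
  have limL: "limitin mtopology (\<lambda>k. e (u k)) (L u) sequentially" if "K u" for u
  proof -
    have "\<exists>l. limitin mtopology (\<lambda>k. e (u k)) l sequentially"
      using that Sd(2) unfolding K_def mcomplete_def by blast
    from someI_ex[OF this] that show ?thesis by (simp add: L_def)
  qed
  have LS: "L u \<in> S" for u
  proof (cases "K u")
    case True
    show ?thesis by (rule limitin_mspace[OF limL[OF True]])
  qed (auto simp: L_def eS)
  have Lg: "L (g x) = x" if x: "x \<in> S" for x
  proof -
    have "(\<lambda>k. d (e (g x k)) x) \<longlonglongrightarrow> 0"
    proof (rule tendsto_sandwich[OF _ _ tendsto_const LIMSEQ_inverse_real_of_nat])
      show "\<forall>\<^sub>F k in sequentially. d (e (g x k)) x \<le> inverse (real (Suc k))"
        using dg[OF x] by (auto simp: commute less_imp_le)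
    qed auto
    then have lim: "limitin mtopology (\<lambda>k. e (g x k)) x sequentially"
      unfolding limitin_metric_dist_null using x eS by auto
    have "range (\<lambda>k. e (g x k)) \<subseteq> S" using eS by auto
    then have "K (g x)" unfolding K_def by (rule convergent_imp_MCauchy[OF _ lim])
    then show ?thesis using limitin_metric_unique[OF limL lim] trivial_limit_sequentially by blast
  qed
  \<comment> \<open>With tolerances \<open>1 / (j + 1)\<close> the Cauchy condition has only
    countable quantifiers, so the set of good codes is Borel.\<close>
  have Kalt: "K u \<longleftrightarrow> (\<forall>j. \<exists>N. \<forall>n n'. N \<le> n \<longrightarrow> N \<le> n' \<longrightarrow> d (e (u n)) (e (u n')) < inverse (of_nat (Suc j)))" for u
  proof
    assume "\<forall>j. \<exists>N. \<forall>n n'. N \<le> n \<longrightarrow> N \<le> n' \<longrightarrow> d (e (u n)) (e (u n')) < inverse (of_nat (Suc j))"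
    then have "\<exists>N. \<forall>n n'. N \<le> n \<longrightarrow> N \<le> n' \<longrightarrow> d (e (u n)) (e (u n')) < r" if "r > 0" for r
      using reals_Archimedean[OF that] by (meson order.strict_trans)
    then show "K u" unfolding K_def MCauchy_def using eS by auto
  qed (auto simp: K_def MCauchy_def)
  have [measurable]: "Measurable.pred borel (\<lambda>u. d (e (u n)) (e (u n')) < c)" for n n' :: nat and c
  proof -
    have "Measurable.pred borel (\<lambda>u :: nat \<Rightarrow> nat. d (e a) (e (u n')) < c)" for a
      by (rule measurable_compose[OF borel_measurable_baire_coordinate[of n'], of "\<lambda>b. d (e a) (e b) < c"]) simp
    then show ?thesis
      by (rule measurable_compose_countable) (rule borel_measurable_baire_coordinate)
  qed
  have [measurable]: "Measurable.pred borel K" unfolding Kalt[abs_def] by measurable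
  \<comment> \<open>On good codes this distance is a pointwise limit of functions of a single
    digit.\<close>
  have mL: "(\<lambda>u. d (L u) (e i)) \<in> borel_measurable borel" for i
  proof -
    have [measurable]: "(\<lambda>u :: nat \<Rightarrow> nat. d (e (u n)) (e i)) \<in> borel_measurable borel" for n
      by (rule measurable_compose[where N = "count_space UNIV" and g = "\<lambda>a. d (e a) (e i)"])
        (simp_all add: borel_measurable_baire_coordinate)
    have eq: "d (L u) (e i) = (if K u then lim (\<lambda>n. d (e (u n)) (e i)) else d (e 0) (e i))" for u
    proof (cases "K u")
      case True
      have "(\<lambda>n. d (e (u n)) (e i)) \<longlonglongrightarrow> d (L u) (e i)"
      proof (rule LIM_zero_cancel, rule tendsto_sandwich)
        show "(\<lambda>n. - d (e (u n)) (L u)) \<longlonglongrightarrow> 0" "(\<lambda>n. d (e (u n)) (L u)) \<longlonglongrightarrow> 0"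
          using limL[OF True] unfolding limitin_metric_dist_null by (auto intro: tendsto_eq_intros)
        have "- d (e (u n)) (L u) \<le> d (e (u n)) (e i) - d (L u) (e i)"
          "d (e (u n)) (e i) - d (L u) (e i) \<le> d (e (u n)) (L u)" for n
          using triangle[OF eS[of "u n"] LS[of u] eS[of i]] triangle[OF LS[of u] eS[of "u n"] eS[of i]]
            commute[of "L u" "e (u n)"] by auto
        then show "\<forall>\<^sub>F n in sequentially. - d (e (u n)) (L u) \<le> d (e (u n)) (e i) - d (L u) (e i)"
          "\<forall>\<^sub>F n in sequentially. d (e (u n)) (e i) - d (L u) (e i) \<le> d (e (u n)) (L u)" by auto
      qed
      then show ?thesis using True limI by fastforce
    qed (auto simp: L_def)
    show ?thesis unfolding eq by measurable
  qed
  have L: "L \<in> borel \<rightarrow>\<^sub>M M"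
  proof (rule measurable_sigma_sets[OF T(4)])
    show "{U. openin T U} \<subseteq> Pow (space M)" using openin_subset T(1) by blast
    show "L \<in> space borel \<rightarrow> space M" using LS S by auto
    fix U assume "U \<in> {U. openin T U}"
    then have U: "openin mtopology U" using Sd(3) by simp
    \<comment> \<open>The balls around dense points of radius \<open>1 / (j + 1)\<close> inside
      \<open>U\<close> exhaust \<open>U\<close>, so the preimage of \<open>U\<close> is a countable
      union of conditions on the distances in \<open>mL\<close>.\<close>
    define I where "I = {(i, j). mball (e i) (inverse (of_nat (Suc j))) \<subseteq> U}"
    have "L -` U = (\<Union>(i,j)\<in>I. {u. d (L u) (e i) < inverse (of_nat (Suc j))})"
    proof (intro equalityI subsetI)
      fix u assume "u \<in> L -` U"
      then obtain r where r: "r > 0" "mball (L u) r \<subseteq> U"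
        using U unfolding openin_mtopology by auto
      obtain j where j: "inverse (real (Suc j)) < r / 2" using reals_Archimedean[of "r/2"] r by auto
      obtain i where i: "d (L u) (e i) < inverse (real (Suc j))" using dense[OF LS] by (meson inverse_positive_iff_positive of_nat_0_less_iff zero_less_Suc)
      have "mball (e i) (inverse (real (Suc j))) \<subseteq> mball (L u) r"
      proof
        fix y assume "y \<in> mball (e i) (inverse (real (Suc j)))"
        then show "y \<in> mball (L u) r"
          using triangle[OF LS[of u] eS[of i], of y] i j LS eS by auto
      qed
      then have "(i, j) \<in> I" using r by (auto simp: I_def)
      then show "u \<in> (\<Union>(i,j)\<in>I. {u. d (L u) (e i) < inverse (of_nat (Suc j))})" using i by auto
    next
      fix u assume "u \<in> (\<Union>(i,j)\<in>I. {u. d (L u) (e i) < inverse (of_nat (Suc j))})"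
      then obtain i j where ij: "(i, j) \<in> I" "d (L u) (e i) < inverse (of_nat (Suc j))" by auto
      then have "L u \<in> mball (e i) (inverse (of_nat (Suc j)))" using LS eS by (auto simp: commute)
      then show "u \<in> L -` U" using ij by (auto simp: I_def)
    qed
    moreover have "{u. d (L u) (e i) < c} \<in> sets borel" for i c
      using mL[of i] borel_measurable_iff_less[of "\<lambda>u. d (L u) (e i)" borel] by simp
    ultimately have "L -` U \<in> sets borel" by (auto intro!: sets.countable_UN')
    then show "L -` U \<inter> space borel \<in> sets borel" by simp
  qed
  show ?thesis using g L Lg S unfolding baire_retract_def by blast
qed

lemma borel_measurable_reindex:
  "(\<lambda>u :: nat \<Rightarrow> nat. (\<lambda>i :: nat. u (s i))) \<in> borel_measurable borel"
  by (rule borel_measurable_baireI) (rule borel_measurable_baire_coordinate)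

lemma borel_measurable_interleave:
  assumes "f \<in> borel_measurable M" "g \<in> borel_measurable M"
  shows "(\<lambda>x. interleave (f x) (g x) :: nat \<Rightarrow> nat) \<in> borel_measurable M"
proof (rule borel_measurable_baireI)
  show "(\<lambda>x. interleave (f x) (g x) k) \<in> M \<rightarrow>\<^sub>M count_space UNIV" for k
    using borel_measurable_baireD[OF assms(1)] borel_measurable_baireD[OF assms(2)]
    by (cases "even k") (simp_all add: interleave_def)
qed

lemma baire_retract_pair:
  assumes "baire_retract M g L" "baire_retract M' g' L'"
  shows "baire_retract (M \<Otimes>\<^sub>M M') (\<lambda>p. interleave (g (fst p)) (g' (snd p))) (\<lambda>u. (L (evens u), L' (odds u)))"
proof -
  have m: "g \<in> borel_measurable M" "g' \<in> borel_measurable M'" "L \<in> borel \<rightarrow>\<^sub>M M" "L' \<in> borel \<rightarrow>\<^sub>M M'"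
    using assms by (auto simp: baire_retract_def)
  have eo: "evens \<in> borel \<rightarrow>\<^sub>M (borel :: (nat \<Rightarrow> nat) measure)" "odds \<in> borel \<rightarrow>\<^sub>M (borel :: (nat \<Rightarrow> nat) measure)"
    unfolding evens_def[abs_def] odds_def[abs_def] by (rule borel_measurable_reindex)+
  have "(\<lambda>p. interleave (g (fst p)) (g' (snd p))) \<in> borel_measurable (M \<Otimes>\<^sub>M M')"
    by (intro borel_measurable_interleave measurable_compose[OF measurable_fst m(1)] measurable_compose[OF measurable_snd m(2)])
  moreover have "(\<lambda>u. (L (evens u), L' (odds u))) \<in> borel \<rightarrow>\<^sub>M (M \<Otimes>\<^sub>M M')"
    by (intro measurable_Pair measurable_compose[OF eo(1) m(3)] measurable_compose[OF eo(2) m(4)])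
  ultimately show ?thesis using assms by (auto simp: baire_retract_def space_pair_measure)
qed

section \<open>Separation of projections and extension of single-valued sets\<close>

text \<open>The sets are pulled back to codes along \<open>L\<close> and \<open>L'\<close>. A code
  common to all projections there would decode to a common point of the original ones, so Novikov's
  theorem applies; its separators return to \<open>M\<close> along \<open>g\<close>.\<close>

lemma novikov_separation_projections:
  assumes ret: "baire_retract M g L" "baire_retract M' g' L'"
    and R: "\<And>n :: nat. R n \<in> sets (M \<Otimes>\<^sub>M M')" and disj: "(\<Inter>n. fst ` R n) = {}"
  shows "\<exists>B. (\<forall>n. B n \<in> sets M \<and> fst ` R n \<subseteq> B n) \<and> (\<Inter>n. B n) = {}"
proof -
  have [measurable]: "g \<in> borel_measurable M" "g' \<in> borel_measurable M'" "L \<in> borel \<rightarrow>\<^sub>M M" "L' \<in> borel \<rightarrow>\<^sub>M M'"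
    using ret by (auto simp: baire_retract_def)
  have RM: "R n \<subseteq> space M \<times> space M'" for n using sets.sets_into_space[OF R] by (simp add: space_pair_measure)
  define R' where "R' = (\<lambda>n. {p. (L (fst p), L' (snd p)) \<in> R n})"
  have "analytic (fst ` R' n)" for n
  proof (rule analytic_fst_image_borel)
    have "(\<lambda>p. (L (fst p), L' (snd p))) \<in> borel \<Otimes>\<^sub>M borel \<rightarrow>\<^sub>M M \<Otimes>\<^sub>M M'" by measurable
    then have "(\<lambda>p. (L (fst p), L' (snd p))) -` R n \<inter> space (borel \<Otimes>\<^sub>M borel) \<in> sets (borel \<Otimes>\<^sub>M borel)"
      using R by (rule measurable_sets)
    moreover have "sets (borel \<Otimes>\<^sub>M borel) = sets (borel :: ((nat \<Rightarrow> nat) \<times> (nat \<Rightarrow> nat)) measure)"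
      by (rule arg_cong[OF borel_prod])
    ultimately show "R' n \<in> sets borel" by (simp add: R'_def vimage_def space_pair_measure)
  qed
  moreover have "(\<Inter>n. fst ` R' n) = {}"
  proof -
    have "L u \<in> fst ` R n" if "u \<in> fst ` R' n" for u n using that by (force simp: R'_def)
    then have "L u \<in> (\<Inter>n. fst ` R n)" if "u \<in> (\<Inter>n. fst ` R' n)" for u
      using that by (metis INT_E INT_I UNIV_I)
    then show ?thesis unfolding disj by (metis emptyE equals0I)
  qed
  ultimately have "borel_separable (\<lambda>n. fst ` R' n)" by (rule novikov_separation)
  then obtain C where C: "\<And>n. C n \<in> sets borel" "\<And>n. fst ` R' n \<subseteq> C n" "(\<Inter>n. C n) = {}"
    unfolding borel_separable_def by blast
  show ?thesis
  proof (intro exI[of _ "\<lambda>n. g -` C n \<inter> space M"] conjI allI)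
    show "g -` C n \<inter> space M \<in> sets M" for n using C(1) by measurable
    show "fst ` R n \<subseteq> g -` C n \<inter> space M" for n
    proof
      fix x assume "x \<in> fst ` R n"
      then obtain y where xy: "(x, y) \<in> R n" by auto
      then have s: "x \<in> space M" "y \<in> space M'" using RM by auto
      then have "(g x, g' y) \<in> R' n" using ret xy by (simp add: R'_def baire_retract_def)
      then show "x \<in> g -` C n \<inter> space M" using C(2)[of n] s by force
    qed
    show "(\<Inter>n. g -` C n \<inter> space M) = {}" using C(3) by auto
  qed
qed

lemma pred_eq_countable:
  fixes f g :: "'a \<Rightarrow> 'c::countable"
  assumes "f \<in> M \<rightarrow>\<^sub>M count_space UNIV" "g \<in> M \<rightarrow>\<^sub>M count_space UNIV"
  shows "Measurable.pred M (\<lambda>x. f x = g x)"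
  by (rule measurable_compose_countable[OF _ assms(1), where f = "\<lambda>i x. i = g x"]) (use assms(2) in measurable)

lemma separate_disjoint_projections:
  assumes ret: "baire_retract M g L" "baire_retract M' g' L'"
    and R: "\<And>n :: nat. R n \<in> sets (M \<Otimes>\<^sub>M M')" and disj: "\<And>i j. i \<noteq> j \<Longrightarrow> fst ` R i \<inter> fst ` R j = {}"
  shows "\<exists>D. \<forall>i. D i \<in> sets M \<and> fst ` R i \<subseteq> D i \<and> (\<forall>j. j \<noteq> i \<longrightarrow> D i \<inter> fst ` R j = {})"
proof -
  have "\<exists>C. C \<in> sets M \<and> fst ` R i \<subseteq> C \<and> (j \<noteq> i \<longrightarrow> C \<inter> fst ` R j = {})" for i j
  proof (cases "j = i")
    case True
    have "fst ` R i \<subseteq> space M" using sets.sets_into_space[OF R[of i]] by (auto simp: space_pair_measure)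
    then show ?thesis using True by (intro exI[of _ "space M"]) auto
  next
    case False
    \<comment> \<open>Repeating \<open>R j\<close> at every index but 0 turns the sequence version
      into separation of two sets: a point of \<open>B 0\<close> in the projection of
      \<open>R j\<close> would lie in every \<open>B n\<close>.\<close>
    have "(\<Inter>n. fst ` (if n = (0::nat) then R i else R j)) \<subseteq> fst ` R i \<inter> fst ` R j"
      using INT_lower[of "0::nat" UNIV "\<lambda>n. fst ` (if n = 0 then R i else R j)"]
        INT_lower[of "1::nat" UNIV "\<lambda>n. fst ` (if n = 0 then R i else R j)"] by simp
    then have "(\<Inter>n. fst ` (if n = (0::nat) then R i else R j)) = {}" using disj[of i j] False by auto
    moreover have "(if n = (0::nat) then R i else R j) \<in> sets (M \<Otimes>\<^sub>M M')" for n using R by simp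
    ultimately have "\<exists>B. (\<forall>n. B n \<in> sets M \<and> fst ` (if n = (0::nat) then R i else R j) \<subseteq> B n) \<and> (\<Inter>n. B n) = {}"
      by (intro novikov_separation_projections[OF ret])
    then obtain B where B: "\<And>n::nat. B n \<in> sets M" "\<And>n. fst ` (if n = 0 then R i else R j) \<subseteq> B n" "(\<Inter>n. B n) = {}"
      by blast
    have "fst ` R i \<subseteq> B 0" using B(2)[of 0] by simp
    moreover have "B 0 \<inter> fst ` R j = {}"
    proof -
      have "x \<in> (\<Inter>n. B n)" if "x \<in> B 0" "x \<in> fst ` R j" for x
      proof
        show "x \<in> B n" for n using that B(2)[of n] by (cases "n = 0") auto
      qed
      then show ?thesis using B(3) by blast
    qed
    ultimately show ?thesis by (intro exI[of _ "B 0"] conjI impI B(1))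
  qed
  then obtain C where C: "\<And>i j. C i j \<in> sets M" "\<And>i j. fst ` R i \<subseteq> C i j" "\<And>i j. j \<noteq> i \<Longrightarrow> C i j \<inter> fst ` R j = {}"
    by metis
  show ?thesis
  proof (intro exI[of _ "\<lambda>i. \<Inter>j. C i j"] allI conjI impI)
    show "(\<Inter>j. C i j) \<in> sets M" for i using C(1) by auto
    show "fst ` R i \<subseteq> (\<Inter>j. C i j)" for i using C(2) by blast
    show "(\<Inter>j. C i j) \<inter> fst ` R j = {}" if "j \<noteq> i" for i j using C(3)[OF that] by blast
  qed
qed

text \<open>For fixed \<open>n\<close>, the value of the \<open>n\<close>-th code digit of
  \<open>y\<close> splits the projection of \<open>Q\<close> into disjoint analytic pieces. Borel
  sets separating them allow the digit to be read off from \<open>x\<close> alone.\<close>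

lemma single_valued_subset_graph:
  assumes ret: "baire_retract M g L" "baire_retract M' g' L'"
    and Q: "Q \<in> sets (M \<Otimes>\<^sub>M M')" and sv: "single_valued Q"
  shows "\<exists>h. h \<in> M \<rightarrow>\<^sub>M M' \<and> (\<forall>(x, y)\<in>Q. h x = y)"
proof -
  have [measurable]: "g' \<in> borel_measurable M'" "L' \<in> borel \<rightarrow>\<^sub>M M'"
    using ret by (auto simp: baire_retract_def)
  have QM: "Q \<subseteq> space M \<times> space M'" using sets.sets_into_space[OF Q] by (simp add: space_pair_measure)
  define R where "R = (\<lambda>n i. {p \<in> Q. g' (snd p) n = i})"
  have mR: "R n i \<in> sets (M \<Otimes>\<^sub>M M')" for n i
  proof -
    have [measurable]: "(\<lambda>p. g' (snd p) n) \<in> M \<Otimes>\<^sub>M M' \<rightarrow>\<^sub>M count_space UNIV"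
      by (rule borel_measurable_baireD) measurable
    have "R n i = Q \<inter> {p \<in> space (M \<Otimes>\<^sub>M M'). g' (snd p) n = i}" using QM by (auto simp: R_def space_pair_measure)
    also have "\<dots> \<in> sets (M \<Otimes>\<^sub>M M')" using Q by measurable
    finally show ?thesis .
  qed
  have "fst ` R n i \<inter> fst ` R n j = {}" if "i \<noteq> j" for n i j
  proof -
    have False if "x \<in> fst ` R n i" "x \<in> fst ` R n j" for x
    proof -
      from that(1) obtain y where y: "(x, y) \<in> Q" "g' y n = i" by (auto simp: R_def)
      from that(2) obtain z where z: "(x, z) \<in> Q" "g' z n = j" by (auto simp: R_def)
      have "y = z" by (rule single_valuedD[OF sv y(1) z(1)])
      then show False using y z \<open>i \<noteq> j\<close> by simp
    qed
    then show ?thesis by blast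
  qed
  then have "\<exists>D. \<forall>i. D i \<in> sets M \<and> fst ` R n i \<subseteq> D i \<and> (\<forall>j. j \<noteq> i \<longrightarrow> D i \<inter> fst ` R n j = {})" for n
    by (intro separate_disjoint_projections[OF ret] mR)
  then obtain D where D: "\<And>n i. D n i \<in> sets M" "\<And>n i. fst ` R n i \<subseteq> D n i"
      "\<And>n i j. j \<noteq> i \<Longrightarrow> D n i \<inter> fst ` R n j = {}"
    by metis
  \<comment> \<open>Over the projection of \<open>Q\<close> exactly one \<open>D n i\<close>
    contains \<open>x\<close>. Elsewhere any digit will do, because \<open>L'\<close> decodes every
    code to a point of the space.\<close>
  define h where "h = (\<lambda>x n. LEAST i. x \<in> D n i)"
  have [measurable]: "h \<in> borel_measurable M"
  proof (rule borel_measurable_baireI)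
    note D(1)[measurable]
    show "(\<lambda>x. h x n) \<in> M \<rightarrow>\<^sub>M count_space UNIV" for n unfolding h_def by measurable
  qed
  have "L' (h x) = y" if xy: "(x, y) \<in> Q" for x y
  proof -
    have "h x n = g' y n" for n
    proof -
      have "(x, y) \<in> R n (g' y n)" using xy by (simp add: R_def)
      then have x: "x \<in> fst ` R n (g' y n)" by force
      show ?thesis unfolding h_def
      proof (rule Least_equality)
        show "x \<in> D n (g' y n)" using x D(2) by blast
        show "g' y n \<le> i" if "x \<in> D n i" for i
          using D(3)[of "g' y n" i n] x that by (cases "g' y n = i") auto
      qed
    qed
    then have "h x = g' y" by auto
    then show ?thesis using ret QM xy by (auto simp: baire_retract_def)
  qed
  then show ?thesis by (intro exI[of _ "\<lambda>x. L' (h x)"]) auto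
qed

text \<open>The finite-section case of the Lusin--Novikov uniformization theorem. The set \<open>Z k\<close> of points
  that have a companion in the same section with the same first \<open>k\<close> code digits is analytic, and
  finiteness makes the \<open>Z k\<close> have empty intersection.\<close>

theorem finite_sections_uniformization:
  assumes ret: "baire_retract M g L" "baire_retract M' g' L'"
    and P: "P \<in> sets (M \<Otimes>\<^sub>M M')" and fin: "\<And>x. finite {y. (x, y) \<in> P}"
  shows "\<exists>f :: nat \<Rightarrow> 'a \<Rightarrow> 'b. (\<forall>k. f k \<in> M \<rightarrow>\<^sub>M M') \<and> (\<forall>(x, y)\<in>P. \<exists>k. f k x = y)"
proof -
  have [measurable]: "g' \<in> borel_measurable M'" using ret by (auto simp: baire_retract_def)
  have PM: "P \<subseteq> space M \<times> space M'" using sets.sets_into_space[OF P] by (simp add: space_pair_measure)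
  define pre where "pre = (\<lambda>k y. map (g' y) [0..<k])"
  have pre_eq: "pre k y = pre k z \<longleftrightarrow> (\<forall>i<k. g' y i = g' z i)" for k y z
    by (auto simp: pre_def)
  have [measurable]: "(\<lambda>y. g' y i) \<in> M' \<rightarrow>\<^sub>M count_space UNIV" for i
    by (rule borel_measurable_baireD) measurable
  have inj: "y = z" if "\<And>i. g' y i = g' z i" "y \<in> space M'" "z \<in> space M'" for y z
    using that ret(2) unfolding baire_retract_def by (metis ext)
  \<comment> \<open>The projection of \<open>R k\<close> to the first two coordinates is the set
    \<open>Z k\<close>. That the companion differs from \<open>y\<close> is said through code
    digits, which makes it a countable condition.\<close>
  define R where "R = (\<lambda>k. {q \<in> space ((M \<Otimes>\<^sub>M M') \<Otimes>\<^sub>M M'). fst q \<in> P \<and> (fst (fst q), snd q) \<in> P \<and>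
        (\<exists>i. g' (snd q) i \<noteq> g' (snd (fst q)) i) \<and> (\<forall>i\<in>{..<k}. g' (snd (fst q)) i = g' (snd q) i)})"
  have R_iff: "((x, y), z) \<in> R k \<longleftrightarrow> (x, y) \<in> P \<and> (x, z) \<in> P \<and> z \<noteq> y \<and> pre k y = pre k z" for x y z k
  proof (cases "(x, y) \<in> P \<and> (x, z) \<in> P")
    case True
    then have s: "x \<in> space M" "y \<in> space M'" "z \<in> space M'" using PM by auto
    have "z \<noteq> y \<longleftrightarrow> (\<exists>i. g' z i \<noteq> g' y i)" using inj[OF _ s(3,2)] by blast
    then show ?thesis using True s by (simp add: R_def space_pair_measure pre_eq Ball_def)
  qed (auto simp: R_def)
  have mR: "R k \<in> sets ((M \<Otimes>\<^sub>M M') \<Otimes>\<^sub>M M')" for k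
  proof -
    have [measurable]: "Measurable.pred ((M \<Otimes>\<^sub>M M') \<Otimes>\<^sub>M M') (\<lambda>q. g' (snd (fst q)) i = g' (snd q) i)" for i
      by (intro pred_eq_countable) measurable
    have [measurable]: "Measurable.pred ((M \<Otimes>\<^sub>M M') \<Otimes>\<^sub>M M') (\<lambda>q. g' (snd q) i = g' (snd (fst q)) i)" for i
      by (intro pred_eq_countable) measurable
    have [measurable]: "Measurable.pred ((M \<Otimes>\<^sub>M M') \<Otimes>\<^sub>M M') (\<lambda>q. \<forall>i\<in>{..<k}. g' (snd (fst q)) i = g' (snd q) i)"
      by (intro pred_intros_finite) simp_all
    show ?thesis unfolding R_def using P by measurable
  qed
  have "(\<Inter>k. fst ` R k) = {}"
  proof -
    have F: False if "\<And>k. (x, y) \<in> fst ` R k" for x y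
    proof -
      have z: "\<exists>z. (x, z) \<in> P \<and> z \<noteq> y \<and> pre k y = pre k z" for k using that[of k] R_iff by fastforce
      have y: "(x, y) \<in> P" using that[of 0] R_iff by fastforce
      have "\<exists>i. (x, z) \<in> P \<longrightarrow> z \<noteq> y \<longrightarrow> g' z i \<noteq> g' y i" for z
        using inj[of z y] PM y by (cases "(x, z) \<in> P") auto
      then obtain i where i: "\<And>z. (x, z) \<in> P \<Longrightarrow> z \<noteq> y \<Longrightarrow> g' z (i z) \<noteq> g' y (i z)" by metis
      have "finite (i ` {z. (x, z) \<in> P})" using fin by auto
      then obtain k where k: "\<And>z. (x, z) \<in> P \<Longrightarrow> i z < k"
        unfolding finite_nat_set_iff_bounded by auto
      obtain z where "(x, z) \<in> P" "z \<noteq> y" "pre k y = pre k z" using z by blast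
      then show False using i[of z] k[of z] unfolding pre_eq by auto
    qed
    show ?thesis
    proof (rule equals0I)
      fix p assume "p \<in> (\<Inter>k. fst ` R k)"
      then have "(fst p, snd p) \<in> fst ` R k" for k by simp
      then show False by (rule F)
    qed
  qed
  then have "\<exists>W. (\<forall>k. W k \<in> sets (M \<Otimes>\<^sub>M M') \<and> fst ` R k \<subseteq> W k) \<and> (\<Inter>k. W k) = {}"
    by (intro novikov_separation_projections[OF baire_retract_pair[OF ret] ret(2)] mR)
  then obtain W where W: "\<And>k. W k \<in> sets (M \<Otimes>\<^sub>M M')" "\<And>k. fst ` R k \<subseteq> W k" "(\<Inter>k. W k) = {}"
    by blast
  \<comment> \<open>Outside \<open>W k\<close> no companion shares the first \<open>k\<close>
    digits, so fixing these digits to be \<open>s\<close> leaves at most one point in each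
    section.\<close>
  define Q where "Q = (\<lambda>k s. {p \<in> P - W k. pre k (snd p) = s})"
  have "\<exists>h. h \<in> M \<rightarrow>\<^sub>M M' \<and> (\<forall>(x, y)\<in>Q k s. h x = y)" for k s
  proof (rule single_valued_subset_graph[OF ret])
    have "Q k s = (P - W k) \<inter> {p \<in> space (M \<Otimes>\<^sub>M M'). length s = k \<and> (\<forall>i<k. g' (snd p) i = s ! i)}"
      using PM by (auto simp: Q_def pre_def space_pair_measure list_eq_iff_nth_eq)
    also have "\<dots> \<in> sets (M \<Otimes>\<^sub>M M')" using P W(1) by measurable
    finally show "Q k s \<in> sets (M \<Otimes>\<^sub>M M')" .
    show "single_valued (Q k s)"
    proof (rule single_valuedI, rule ccontr)
      fix x y z assume a: "(x, y) \<in> Q k s" "(x, z) \<in> Q k s" "y \<noteq> z"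
      then have "((x, y), z) \<in> R k" by (auto simp: R_iff Q_def)
      then have "(x, y) \<in> W k" using W(2) by force
      then show False using a by (auto simp: Q_def)
    qed
  qed
  then obtain h where h: "\<And>k s. h k s \<in> M \<rightarrow>\<^sub>M M'" "\<And>k s x y. (x, y) \<in> Q k s \<Longrightarrow> h k s x = y"
    by (metis (mono_tags, lifting) case_prodD)
  define f where "f = (\<lambda>n. case from_nat n of (k, s) \<Rightarrow> h k s)"
  have "\<exists>n. f n x = y" if xy: "(x, y) \<in> P" for x y
  proof -
    obtain k where "(x, y) \<notin> W k" using W(3) by blast
    then have "(x, y) \<in> Q k (pre k y)" using xy by (auto simp: Q_def)
    then have "f (to_nat (k, pre k y)) x = y" using h(2) by (simp add: f_def)
    then show ?thesis by blast
  qed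
  moreover have "f n \<in> M \<rightarrow>\<^sub>M M'" for n using h(1) by (simp add: f_def split: prod.split)
  ultimately show ?thesis by blast
qed

text \<open>Each candidate looks up the first \<open>k\<close> code digits in a finite table, and
  there are only countably many pairs of a \<open>k\<close> and a table. Long enough prefixes tell
  the points of a finite set apart, so a table can prescribe any values on it.\<close>

lemma measurable_finite_interpolation:
  fixes g :: "'a \<Rightarrow> nat \<Rightarrow> nat"
  assumes g: "g \<in> borel_measurable M" and inj: "inj_on g (space M)"
  shows "\<exists>h :: nat \<Rightarrow> 'a \<Rightarrow> nat. (\<forall>i. h i \<in> M \<rightarrow>\<^sub>M count_space UNIV) \<and>
    (\<forall>F c. finite F \<longrightarrow> F \<subseteq> space M \<longrightarrow> (\<exists>i. \<forall>x\<in>F. h i x = c x))"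
proof -
  define pre where "pre = (\<lambda>k x. map (g x) [0..<k])"
  have pre: "pre k \<in> M \<rightarrow>\<^sub>M count_space UNIV" for k
    unfolding measurable_count_space_eq2_countable
  proof (intro conjI ballI)
    fix s :: "nat list"
    have m: "{x \<in> space M. g x i = a} \<in> sets M" for i a
    proof -
      have "(\<lambda>x. g x i) -` {a} \<inter> space M \<in> sets M" by (rule measurable_sets[OF borel_measurable_baireD[OF g]]) simp
      then show ?thesis by (simp add: vimage_def Int_def conj_commute)
    qed
    have "pre k -` {s} \<inter> space M = (if length s = k then {x \<in> space M. \<forall>i\<in>{..<k}. g x i = s ! i} else {})"
    proof -
      have "pre k x = s \<longleftrightarrow> length s = k \<and> (\<forall>i<k. g x i = s ! i)" for x
        by (auto simp: pre_def list_eq_iff_nth_eq)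
      then show ?thesis by auto
    qed
    also have "\<dots> \<in> sets M"
    proof -
      have "{x \<in> space M. \<forall>i\<in>{..<k}. g x i = s ! i} \<in> sets M"
        by (rule sets.sets_Collect_finite_All) (auto intro: m)
      then show ?thesis by simp
    qed
    finally show "pre k -` {s} \<inter> space M \<in> sets M" .
  qed simp
  \<comment> \<open>Prefixes missing from the table get the default value 0.\<close>
  define e where "e = (\<lambda>(l :: (nat list \<times> nat) list) s. case map_of l s of None \<Rightarrow> 0 | Some a \<Rightarrow> a)"
  define h where "h = (\<lambda>n x. case from_nat n of (k, l) \<Rightarrow> e l (pre k x))"
  have "h n \<in> M \<rightarrow>\<^sub>M count_space UNIV" for n
  proof -
    obtain k l where "from_nat n = (k :: nat, l :: (nat list \<times> nat) list)" by (rule prod.exhaust)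
    then have "h n = (\<lambda>x. e l (pre k x))" by (simp add: h_def fun_eq_iff)
    then show ?thesis using measurable_compose[OF pre[of k], of "e l" "count_space UNIV"] by simp
  qed
  moreover have "\<exists>i. \<forall>x\<in>F. h i x = c x" if F: "finite F" "F \<subseteq> space M" for F c
  proof -
    have "\<exists>i. x \<noteq> y \<longrightarrow> g x i \<noteq> g y i" if "x \<in> F" "y \<in> F" for x y
      using inj_onD[OF inj, of x y] F(2) that by (metis ext subsetD)
    then obtain i where i: "\<And>x y. x \<in> F \<Longrightarrow> y \<in> F \<Longrightarrow> x \<noteq> y \<Longrightarrow> g x (i x y) \<noteq> g y (i x y)" by metis
    have "finite ((\<lambda>(x, y). i x y) ` (F \<times> F))" using F by simp
    then obtain k where k: "\<And>x y. x \<in> F \<Longrightarrow> y \<in> F \<Longrightarrow> i x y < k"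
      unfolding finite_nat_set_iff_bounded by auto
    have "inj_on (pre k) F"
    proof (rule inj_onI, rule ccontr)
      fix x y assume xy: "x \<in> F" "y \<in> F" "pre k x = pre k y" "x \<noteq> y"
      then have "g x (i x y) = g y (i x y)" using k[OF xy(1,2)] by (simp add: pre_def)
      then show False using i xy by blast
    qed
    obtain xs where xs: "set xs = F" "distinct xs" using finite_distinct_list[OF F(1)] by blast
    define l where "l = map (\<lambda>x. (pre k x, c x)) xs"
    have "map_of l (pre k x) = Some (c x)" if "x \<in> F" for x
    proof (rule map_of_is_SomeI)
      show "distinct (map fst l)"
        using xs \<open>inj_on (pre k) F\<close> by (simp add: l_def comp_def distinct_map)
      show "(pre k x, c x) \<in> set l" using that xs by (auto simp: l_def)
    qed
    then have "\<forall>x\<in>F. h (to_nat (k, l)) x = c x" by (simp add: h_def e_def)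
    then show ?thesis by blast
  qed
  ultimately show ?thesis by blast
qed

section \<open>Colourings with bounded monochromatic chains\<close>

definition step :: "('a \<Rightarrow> 'a \<Rightarrow> ennreal) \<Rightarrow> ennreal \<Rightarrow> 'a set \<Rightarrow> ('a \<Rightarrow> nat) \<Rightarrow> ('a \<times> 'a) set" where
  "step \<rho> r Y c = {(x, y). x \<in> Y \<and> y \<in> Y \<and> \<rho> x y \<le> r \<and> c x = c y}"

text \<open>A diameter bound for the monochromatic \<open>r\<close>-components. With the constant
  colouring \<open>\<lambda>_. 0\<close> it concerns the plain \<open>r\<close>-components of
  \<open>Y\<close>.\<close>

definition chains_bounded :: "('a \<Rightarrow> 'a \<Rightarrow> ennreal) \<Rightarrow> ennreal \<Rightarrow> ennreal \<Rightarrow> 'a set \<Rightarrow> ('a \<Rightarrow> nat) \<Rightarrow> bool" where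
  "chains_bounded \<rho> r D Y c \<longleftrightarrow> (\<forall>x y. (x, y) \<in> (step \<rho> r Y c)\<^sup>+ \<longrightarrow> \<rho> x y \<le> D)"

lemma stepI: "x \<in> Y \<Longrightarrow> y \<in> Y \<Longrightarrow> \<rho> x y \<le> r \<Longrightarrow> c x = c y \<Longrightarrow> (x, y) \<in> step \<rho> r Y c"
  and stepD: "(x, y) \<in> step \<rho> r Y c \<Longrightarrow> x \<in> Y \<and> y \<in> Y \<and> \<rho> x y \<le> r \<and> c x = c y"
  by (auto simp: step_def)

lemma step_mono: "r \<le> s \<Longrightarrow> step \<rho> r Y c \<subseteq> step \<rho> s Y c"
  by (auto simp: step_def)

lemma trancl_stepD: "(x, y) \<in> (step \<rho> r Y c)\<^sup>+ \<Longrightarrow> x \<in> Y \<and> y \<in> Y \<and> c x = c y"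
  by (induction rule: trancl_induct) (auto simp: step_def)

lemma chains_boundedD: "chains_bounded \<rho> r D Y c \<Longrightarrow> (x, y) \<in> (step \<rho> r Y c)\<^sup>+ \<Longrightarrow> \<rho> x y \<le> D"
  by (simp add: chains_bounded_def)

lemma chains_bounded_mono:
  assumes "chains_bounded \<rho> s D Y c" "r \<le> s" "D \<le> D'"
  shows "chains_bounded \<rho> r D' Y c"
  unfolding chains_bounded_def
proof (intro allI impI)
  fix x y assume "(x, y) \<in> (step \<rho> r Y c)\<^sup>+"
  then have "(x, y) \<in> (step \<rho> s Y c)\<^sup>+" using trancl_mono step_mono[OF assms(2)] by blast
  then show "\<rho> x y \<le> D'" using chains_boundedD[OF assms(1)] assms(3) by (meson order_trans)
qed

lemma extended_metric_onD:
  assumes "extended_metric_on X \<rho>" "x \<in> X" "y \<in> X"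
  shows "\<rho> x x = 0" "\<rho> x y = \<rho> y x" "z \<in> X \<Longrightarrow> \<rho> x z \<le> \<rho> x y + \<rho> y z"
  using assms by (auto simp: extended_metric_on_def)

lemma extended_metric_on_triangle:
  assumes "extended_metric_on X \<rho>" "x \<in> X" "y \<in> X" "z \<in> X" "\<rho> x y \<le> a" "\<rho> y z \<le> b"
  shows "\<rho> x z \<le> a + b"
  using extended_metric_onD(3)[OF assms(1-4)] add_mono[OF assms(5,6)] by simp

lemma step_refl:
  assumes "extended_metric_on X \<rho>" "Y \<subseteq> X" "x \<in> Y"
  shows "(x, x) \<in> step \<rho> r Y c"
  using extended_metric_onD(1)[OF assms(1)] assms(2,3) by (auto simp: step_def subset_iff)

lemma sym_step:
  assumes "extended_metric_on X \<rho>" "Y \<subseteq> X"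
  shows "sym (step \<rho> r Y c)"
  using extended_metric_onD(2)[OF assms(1)] assms(2) by (auto simp: step_def sym_def subset_iff)

text \<open>A monochromatic \<open>r\<close>-chain in the union leaves \<open>Y2\<close> only along excursions of diameter at most
  \<open>D1\<close>, so its visits to \<open>Y2\<close> form a chain of mesh \<open>D1 + 2 * r\<close>.\<close>

lemma chains_bounded_Un:
  assumes em: "extended_metric_on X \<rho>" and Y: "Y1 \<subseteq> X" "Y2 \<subseteq> X"
    and b1: "chains_bounded \<rho> r D1 Y1 c1" and b2: "chains_bounded \<rho> (r + (D1 + r)) D2 Y2 c2"
  shows "chains_bounded \<rho> r ((D1 + r) + (D2 + (r + D1))) (Y1 \<union> Y2) (\<lambda>x. if x \<in> Y2 then c2 x else c1 x)"
proof -
  define c where "c = (\<lambda>x. if x \<in> Y2 then c2 x else c1 x)"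
  let ?S1 = "(step \<rho> r Y1 c1)\<^sup>+" and ?S2 = "(step \<rho> (r + (D1 + r)) Y2 c2)\<^sup>+"
  \<comment> \<open>Either the chain has avoided \<open>Y2\<close>, or \<open>u\<close> is its first
    and \<open>v\<close> its latest point in \<open>Y2\<close>, and \<open>w\<close> is the point
    following \<open>v\<close> if an excursion is under way. A return to \<open>Y2\<close> at
    \<open>z\<close> costs \<open>r\<close> to \<open>w\<close>, \<open>D1\<close> along the
    excursion and \<open>r\<close> to \<open>z\<close>, whence the mesh
    \<open>r + (D1 + r)\<close>.\<close>
  have inv: "(x \<notin> Y2 \<and> y \<notin> Y2 \<and> (x, y) \<in> ?S1) \<or>
    (\<exists>u v. (u, v) \<in> ?S2 \<and> c v = c y \<and> \<rho> x u \<le> D1 + r \<and>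
       (y = v \<or> (y \<notin> Y2 \<and> (\<exists>w. \<rho> v w \<le> r \<and> (w, y) \<in> ?S1))))"
    if "(x, y) \<in> (step \<rho> r (Y1 \<union> Y2) c)\<^sup>+" "x \<in> Y1 \<union> Y2" for x y
    using that
  proof (induction rule: trancl_induct)
    case (base y)
    then have b: "(x, y) \<in> step \<rho> r (Y1 \<union> Y2) c" by simp
    note bb = stepD[OF b]
    show ?case
    proof (cases "x \<in> Y2")
      case xT: True
      have xx: "(x, x) \<in> ?S2" using step_refl[OF em Y(2) xT] by blast
      have x0: "\<rho> x x \<le> D1 + r" using extended_metric_onD(1)[OF em] xT Y by auto
      show ?thesis
      proof (cases "y \<in> Y2")
        case True
        have "(x, y) \<in> step \<rho> (r + (D1 + r)) Y2 c2"
          using bb xT True by (auto simp: step_def c_def intro: order_trans)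
        then show ?thesis using x0 by blast
      next
        case False
        have "(y, y) \<in> ?S1" using step_refl[OF em Y(1), of y] bb False by blast
        then show ?thesis using xx x0 bb False by blast
      qed
    next
      case xF: False
      show ?thesis
      proof (cases "y \<in> Y2")
        case True
        have "(y, y) \<in> ?S2" using step_refl[OF em Y(2) True] by blast
        moreover have "\<rho> x y \<le> D1 + r" using bb by (auto intro: order_trans)
        ultimately show ?thesis by blast
      next
        case False
        have "(x, y) \<in> step \<rho> r Y1 c1" using bb xF False by (auto simp: step_def c_def)
        then show ?thesis using xF False by blast
      qed
    qed
  next
    case (step y z)
    note bb = stepD[OF step.hyps(2)]
    from step.IH[OF step.prems] show ?case
    proof (elim disjE exE conjE)
      assume xy: "x \<notin> Y2" "y \<notin> Y2" "(x, y) \<in> ?S1"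
      have xyX: "x \<in> X" "y \<in> X" "z \<in> X" using bb Y step.prems by auto
      show ?thesis
      proof (cases "z \<in> Y2")
        case True
        have "(z, z) \<in> ?S2" using step_refl[OF em Y(2) True] by blast
        moreover have "\<rho> x z \<le> D1 + r"
          by (rule extended_metric_on_triangle[OF em xyX chains_boundedD[OF b1 xy(3)]]) (use bb in simp)
        ultimately show ?thesis by blast
      next
        case False
        have "(y, z) \<in> step \<rho> r Y1 c1" using bb xy False by (auto simp: step_def c_def)
        then show ?thesis using xy False by (meson trancl.trancl_into_trancl)
      qed
    next
      fix u v assume uv: "(u, v) \<in> ?S2" "c v = c y" "\<rho> x u \<le> D1 + r" "y = v"
      have vY: "v \<in> Y2" using trancl_stepD[OF uv(1)] by blast
      show ?thesis
      proof (cases "z \<in> Y2")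
        case True
        have "(v, z) \<in> step \<rho> (r + (D1 + r)) Y2 c2"
          using bb vY True uv(4) by (auto simp: step_def c_def intro: order_trans)
        then have "(u, z) \<in> ?S2" using uv(1) by (meson trancl.trancl_into_trancl)
        then show ?thesis using uv by blast
      next
        case False
        have "(z, z) \<in> ?S1" using step_refl[OF em Y(1), of z] bb False by blast
        then show ?thesis using uv bb False by metis
      qed
    next
      fix u v w assume uv: "(u, v) \<in> ?S2" "c v = c y" "\<rho> x u \<le> D1 + r" "y \<notin> Y2" "\<rho> v w \<le> r" "(w, y) \<in> ?S1"
      have vY: "v \<in> Y2" and wY: "w \<in> Y1" using trancl_stepD[OF uv(1)] trancl_stepD[OF uv(6)] by auto
      have X: "v \<in> X" "w \<in> X" "y \<in> X" "z \<in> X" using vY wY Y bb by auto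
      show ?thesis
      proof (cases "z \<in> Y2")
        case True
        have "\<rho> w z \<le> D1 + r"
          by (rule extended_metric_on_triangle[OF em X(2,3,4) chains_boundedD[OF b1 uv(6)]]) (use bb in simp)
        then have "\<rho> v z \<le> r + (D1 + r)"
          by (rule extended_metric_on_triangle[OF em X(1,2,4) uv(5)])
        moreover have "c2 v = c2 z" using uv(2) bb vY True by (simp add: c_def)
        ultimately have "(v, z) \<in> step \<rho> (r + (D1 + r)) Y2 c2" using vY True by (intro stepI)
        then have "(u, z) \<in> ?S2" using uv(1) by (meson trancl.trancl_into_trancl)
        then show ?thesis using uv(3) by blast
      next
        case False
        have "(y, z) \<in> step \<rho> r Y1 c1" using bb uv(4) False by (auto simp: step_def c_def)
        then have "(w, z) \<in> ?S1" using uv(6) by (meson trancl.trancl_into_trancl)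
        moreover have "c v = c z" using uv(2) bb by simp
        ultimately show ?thesis using uv(1,3,5) False by blast
      qed
    qed
  qed
  \<comment> \<open>The summands are the way from \<open>x\<close> to the first visit
    \<open>u\<close>, the way from \<open>u\<close> to the last visit \<open>v\<close>, and the
    final excursion to \<open>y\<close>.\<close>
  have "\<rho> x y \<le> (D1 + r) + (D2 + (r + D1))" if xy: "(x, y) \<in> (step \<rho> r (Y1 \<union> Y2) c)\<^sup>+" for x y
  proof -
    have xyY: "x \<in> Y1 \<union> Y2" "y \<in> Y1 \<union> Y2" using trancl_stepD[OF xy] by auto
    then have xyX: "x \<in> X" "y \<in> X" using Y by auto
    from inv[OF xy xyY(1)] show ?thesis
    proof (elim disjE exE conjE)
      assume "(x, y) \<in> ?S1"
      from chains_boundedD[OF b1 this] have "\<rho> x y \<le> D1" .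
      also have "\<dots> \<le> (D1 + r) + (D2 + (r + D1))" by (simp add: add.assoc)
      finally show ?thesis .
    next
      fix u v assume uv: "(u, v) \<in> ?S2" "\<rho> x u \<le> D1 + r" "y = v"
      have X: "u \<in> X" using trancl_stepD[OF uv(1)] Y by auto
      have "\<rho> u y \<le> D2" using chains_boundedD[OF b2 uv(1)] uv(3) by simp
      then have "\<rho> u y \<le> D2 + (r + D1)" by (rule order_trans) simp
      then show ?thesis by (rule extended_metric_on_triangle[OF em xyX(1) X xyX(2) uv(2)])
    next
      fix u v w assume uv: "(u, v) \<in> ?S2" "\<rho> x u \<le> D1 + r" "\<rho> v w \<le> r" "(w, y) \<in> ?S1"
      have X: "u \<in> X" "v \<in> X" "w \<in> X"
        using trancl_stepD[OF uv(1)] trancl_stepD[OF uv(4)] Y by auto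
      have "\<rho> v y \<le> r + D1"
        by (rule extended_metric_on_triangle[OF em X(2,3) xyX(2) uv(3) chains_boundedD[OF b1 uv(4)]])
      then have "\<rho> u y \<le> D2 + (r + D1)"
        by (rule extended_metric_on_triangle[OF em X(1,2) xyX(2) chains_boundedD[OF b2 uv(1)]])
      then show ?thesis by (rule extended_metric_on_triangle[OF em xyX(1) X(1) xyX(2) uv(2)])
    qed
  qed
  then show ?thesis unfolding chains_bounded_def c_def by blast
qed

lemma equiv_bounded:
  assumes "equiv X E" "\<And>C. C \<in> X // E \<Longrightarrow> ext_diameter \<rho> C \<le> D" "(x, y) \<in> E"
  shows "\<rho> x y \<le> D"
proof -
  have x: "x \<in> X" using assms(1,3) by (auto simp: equiv_def refl_on_def)
  have "x \<in> E `` {x}" "y \<in> E `` {x}" using assms(3) equiv_class_self[OF assms(1) x] by auto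
  then have "\<rho> x y \<le> ext_diameter \<rho> (E `` {x})" unfolding ext_diameter_def
    by (meson SUP_upper SUP_upper2)
  also have "\<dots> \<le> D" using assms(2) quotientI[OF x] by blast
  finally show ?thesis .
qed

section \<open>Stable parts: from equivalence relations to colourings\<close>

text \<open>The pairs whose second point lies in a class met by the ball of radius \<open>r\<close>
  around the first. This relation and the next set are built with \<open>O\<close> and
  \<open>Domain\<close> because these are the operations for which Borel closure is proved.\<close>

definition neighbours :: "'a set \<Rightarrow> ('a \<Rightarrow> 'a \<Rightarrow> ennreal) \<Rightarrow> ('a \<times> 'a) set \<Rightarrow> ennreal \<Rightarrow> ('a \<times> 'a) set" where
  "neighbours X \<rho> E r = {(x, z). x \<in> X \<and> z \<in> X \<and> \<rho> x z \<le> r} O E"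

text \<open>The points whose ball meets no new class when its radius grows from
  \<open>(i + 1) * r\<close> to \<open>(i + 2) * r\<close>.\<close>

definition stable_part :: "'a set \<Rightarrow> ('a \<Rightarrow> 'a \<Rightarrow> ennreal) \<Rightarrow> ('a \<times> 'a) set \<Rightarrow> ennreal \<Rightarrow> nat \<Rightarrow> 'a set" where
  "stable_part X \<rho> E r i = X - Domain ({(x, y). x \<in> X \<and> y \<in> X \<and> \<rho> x y \<le> of_nat (i + 2) * r} -
     neighbours X \<rho> E (of_nat (i + 1) * r))"

lemma stable_part_iff:
  "x \<in> stable_part X \<rho> E r i \<longleftrightarrow> x \<in> X \<and> (\<forall>y\<in>X. \<rho> x y \<le> of_nat (i + 2) * r \<longrightarrow>
     (\<exists>z\<in>X. \<rho> x z \<le> of_nat (i + 1) * r \<and> (z, y) \<in> E))"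
  unfolding stable_part_def neighbours_def by blast

text \<open>The number of classes met by the balls of radius \<open>r, 2 * r, \<dots>, (d + 2) * r\<close> cannot increase
  \<open>d + 1\<close> times, starting from at least one and staying at most \<open>d + 1\<close>.\<close>

lemma stable_part_cover:
  assumes em: "extended_metric_on X \<rho>" and eq: "equiv X E"
    and meets: "ball_meets_at_most X \<rho> E (of_nat (d + 2) * r) (d + 1)" and x: "x \<in> X"
  shows "\<exists>i\<le>d. x \<in> stable_part X \<rho> E r i"
proof (rule ccontr)
  assume n: "\<not> ?thesis"
  define N where "N = (\<lambda>j. {C \<in> X // E. C \<inter> ext_cball X \<rho> x (of_nat j * r) \<noteq> {}})"
  have mono: "N j \<subseteq> N k" if "j \<le> k" for j k
  proof -
    have "of_nat j * r \<le> of_nat k * r" using that by (intro mult_right_mono) auto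
    then have "ext_cball X \<rho> x (of_nat j * r) \<subseteq> ext_cball X \<rho> x (of_nat k * r)"
      by (auto simp: ext_cball_def)
    then show ?thesis unfolding N_def by blast
  qed
  have fin: "finite (N (d + 2))" and cd: "card (N (d + 2)) \<le> d + 1"
    using meets x unfolding ball_meets_at_most_def N_def by auto
  have "N (i + 1) \<noteq> N (i + 2)" if "i \<le> d" for i
  proof
    assume eqN: "N (i + 1) = N (i + 2)"
    have "x \<in> stable_part X \<rho> E r i" unfolding stable_part_iff
    proof (intro conjI ballI impI x)
      fix y assume y: "y \<in> X" "\<rho> x y \<le> of_nat (i + 2) * r"
      then have "E `` {y} \<in> N (i + 2)"
        using equiv_class_self[OF eq y(1)] quotientI[OF y(1)] by (auto simp: N_def ext_cball_def)
      then have "E `` {y} \<in> N (i + 1)" using eqN by simp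
      then obtain z where "(y, z) \<in> E" "z \<in> X" "\<rho> x z \<le> of_nat (i + 1) * r"
        unfolding N_def ext_cball_def by blast
      then show "\<exists>z\<in>X. \<rho> x z \<le> of_nat (i + 1) * r \<and> (z, y) \<in> E"
        using eq by (meson equivE symD)
    qed
    then show False using n that by blast
  qed
  then have strict: "N (i + 1) \<subset> N (i + 2)" if "i \<le> d" for i using mono[of "i + 1" "i + 2"] that by auto
  have "i + 1 \<le> card (N (i + 1))" if "i \<le> d + 1" for i
    using that
  proof (induction i)
    case 0
    have "E `` {x} \<in> N 1"
      using equiv_class_self[OF eq x] quotientI[OF x] extended_metric_onD(1)[OF em x] x
      by (auto simp: N_def ext_cball_def)
    moreover have "finite (N 1)" using finite_subset[OF mono fin] by simp
    ultimately show ?case by (metis One_nat_def Suc_leI add_0 card_gt_0_iff empty_iff)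
  next
    case (Suc i)
    have "finite (N (i + 2))" using finite_subset[OF mono fin] Suc.prems by simp
    then have "card (N (i + 1)) < card (N (i + 2))"
      by (rule psubset_card_mono) (use strict Suc.prems in simp)
    then show ?case using Suc by simp
  qed
  from this[of "d + 1"] show False using cd by simp
qed

text \<open>The union \<open>S x\<close> of the classes met by the ball of radius
  \<open>(i + 1) * r\<close> is constant along \<open>r\<close>-chains: for a neighbour
  \<open>y\<close> of \<open>x\<close> the corresponding ball lies in the ball of radius
  \<open>(i + 2) * r\<close> around \<open>x\<close>, which meets no new class. The end point of a
  chain lies in its own \<open>S y = S x\<close>, hence within \<open>(i + 1) * r + D\<close> of the
  start.\<close>

lemma stable_part_chains_bounded:
  assumes em: "extended_metric_on X \<rho>" and eq: "equiv X E"
    and D: "\<And>x y. (x, y) \<in> E \<Longrightarrow> \<rho> x y \<le> D"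
  shows "chains_bounded \<rho> r (of_nat (i + 1) * r + D) (stable_part X \<rho> E r i) (\<lambda>_. 0)"
proof -
  define S where "S = (\<lambda>x. {w. \<exists>z\<in>X. \<rho> x z \<le> of_nat (i + 1) * r \<and> (z, w) \<in> E})"
  have EX: "x \<in> X \<and> y \<in> X" if "(x, y) \<in> E" for x y using eq that by (auto simp: equiv_def refl_on_def)
  have sub: "S y \<subseteq> S x" if xy: "x \<in> stable_part X \<rho> E r i" "y \<in> X" "\<rho> x y \<le> r" for x y
  proof
    fix w assume "w \<in> S y"
    then obtain z where z: "z \<in> X" "\<rho> y z \<le> of_nat (i + 1) * r" "(z, w) \<in> E" by (auto simp: S_def)
    have xX: "x \<in> X" using xy(1) by (simp add: stable_part_iff)
    have "\<rho> x z \<le> r + of_nat (i + 1) * r"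
      by (rule extended_metric_on_triangle[OF em xX xy(2) z(1) xy(3) z(2)])
    also have "\<dots> = of_nat (i + 2) * r" by (simp add: distrib_right distrib_left ac_simps)
    finally obtain z' where "z' \<in> X" "\<rho> x z' \<le> of_nat (i + 1) * r" "(z', z) \<in> E"
      using xy(1) z(1) unfolding stable_part_iff by blast
    then show "w \<in> S x" using z(3) eq unfolding S_def by (metis (mono_tags, lifting) equivE mem_Collect_eq transD)
  qed
  have SX: "x \<in> X" if "x \<in> stable_part X \<rho> E r i" for x using that by (simp add: stable_part_iff)
  have "S x = S y" if "(x, y) \<in> (step \<rho> r (stable_part X \<rho> E r i) (\<lambda>_. 0))\<^sup>+" for x y
    using that
  proof (induction rule: trancl_induct)
    case (base y)
    then show ?case using sub[of x y] sub[of y x] extended_metric_onD(2)[OF em, of x y] SX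
      by (auto simp: step_def)
  next
    case (step y z)
    then show ?case using sub[of y z] sub[of z y] extended_metric_onD(2)[OF em, of y z] SX
      by (auto simp: step_def)
  qed
  moreover have "\<rho> x y \<le> of_nat (i + 1) * r + D" if xy: "x \<in> X" "y \<in> X" "S x = S y" for x y
  proof -
    have "(y, y) \<in> E" using eq xy by (auto simp: equiv_def refl_on_def)
    then have "y \<in> S y" using extended_metric_onD(1)[OF em xy(2)] xy(2) by (force simp: S_def)
    then obtain z where "z \<in> X" "\<rho> x z \<le> of_nat (i + 1) * r" "(z, y) \<in> E" using xy by (auto simp: S_def)
    then show ?thesis using extended_metric_on_triangle[OF em xy(1) _ xy(2)] D by blast
  qed
  ultimately show ?thesis unfolding chains_bounded_def using trancl_stepD SX by metis
qed

section \<open>From colourings back to equivalence relations\<close>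

lemma equiv_trancl_step:
  assumes "extended_metric_on X \<rho>" shows "equiv X ((step \<rho> r X c)\<^sup>+)"
proof (rule equivI)
  show "(step \<rho> r X c)\<^sup>+ \<subseteq> X \<times> X" by (intro subrelI) (use trancl_stepD[of _ _ \<rho> r X c] in auto)
  show "refl_on X ((step \<rho> r X c)\<^sup>+)"
    using step_refl[OF assms order_refl] by (auto simp: refl_on_def intro: r_into_trancl)
  show "sym ((step \<rho> r X c)\<^sup>+)" by (rule sym_trancl[OF sym_step[OF assms order_refl]])
  show "trans ((step \<rho> r X c)\<^sup>+)" by (rule trans_trancl)
qed

lemma trancl_step_uniformly_bounded:
  assumes "extended_metric_on X \<rho>" "chains_bounded \<rho> r D X c" "D < \<infinity>"
  shows "uniformly_bounded_on X \<rho> ((step \<rho> r X c)\<^sup>+)"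
  unfolding uniformly_bounded_on_def
proof (intro exI[of _ D] conjI ballI)
  fix C assume "C \<in> X // (step \<rho> r X c)\<^sup>+"
  then have "(x, y) \<in> (step \<rho> r X c)\<^sup>+" if "x \<in> C" "y \<in> C" for x y
    using quotient_eq_iff[OF equiv_trancl_step[OF assms(1)], of C r c C x y] that by blast
  then show "ext_diameter \<rho> C \<le> D"
    unfolding ext_diameter_def by (intro SUP_least chains_boundedD[OF assms(2)])
qed (use assms in simp)

text \<open>Two points of a ball of radius \<open>r\<close> are at distance at most
  \<open>2 * r\<close>, so points of equal colour in it are in the same class: the ball meets at
  most one class per colour.\<close>

lemma trancl_step_ball_meets:
  assumes em: "extended_metric_on X \<rho>" and c: "\<And>x. x \<in> X \<Longrightarrow> c x \<le> d"
  shows "ball_meets_at_most X \<rho> ((step \<rho> (2 * r) X c)\<^sup>+) r (d + 1)"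
  unfolding ball_meets_at_most_def
proof
  fix x assume x: "x \<in> X"
  let ?E = "(step \<rho> (2 * r) X c)\<^sup>+"
  let ?Q = "{C \<in> X // ?E. C \<inter> ext_cball X \<rho> x r \<noteq> {}}"
  define p where "p = (\<lambda>C. SOME y. y \<in> C \<inter> ext_cball X \<rho> x r)"
  have p: "p C \<in> C" "p C \<in> X" "\<rho> x (p C) \<le> r" if "C \<in> ?Q" for C
  proof -
    have "\<exists>y. y \<in> C \<inter> ext_cball X \<rho> x r" using that by blast
    from someI_ex[OF this] show "p C \<in> C" "p C \<in> X" "\<rho> x (p C) \<le> r" by (auto simp: p_def ext_cball_def)
  qed
  have inj: "inj_on (\<lambda>C. c (p C)) ?Q"
  proof (rule inj_onI)
    fix C C' assume C: "C \<in> ?Q" "C' \<in> ?Q" "c (p C) = c (p C')"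
    have "\<rho> (p C) x \<le> r" using p(3)[OF C(1)] extended_metric_onD(2)[OF em x p(2)[OF C(1)]] by simp
    then have "\<rho> (p C) (p C') \<le> r + r"
      by (rule extended_metric_on_triangle[OF em p(2)[OF C(1)] x p(2)[OF C(2)] _ p(3)[OF C(2)]])
    then have "(p C, p C') \<in> ?E"
      using C p(2) by (intro r_into_trancl stepI) (auto simp: mult_2)
    then show "C = C'"
      using quotient_eqI[OF equiv_trancl_step[OF em], of C "2 * r" c C'] C p(1) by blast
  qed
  have sub: "(\<lambda>C. c (p C)) ` ?Q \<subseteq> {..d}" using c p(2) by auto
  have "finite ?Q" using finite_imageD[OF finite_subset[OF sub] inj] by simp
  moreover have "card ?Q \<le> d + 1" using card_inj_on_le[OF inj sub] by simp
  ultimately show "finite ?Q \<and> card ?Q \<le> d + 1" by blast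
qed

text \<open>The colour is the index of the first stable part containing the point, so a
  monochromatic chain stays in a single stable part.\<close>

lemma chains_bounded_colouring_exists:
  assumes em: "extended_metric_on X \<rho>" and r: "r < \<infinity>" and eq: "equiv X E" and ub: "uniformly_bounded_on X \<rho> E"
    and meets: "ball_meets_at_most X \<rho> E (of_nat (d + 2) * r) (d + 1)"
  shows "\<exists>D<\<infinity>. \<exists>c. (\<forall>x\<in>X. c x \<le> d) \<and> chains_bounded \<rho> r D X c"
proof -
  obtain D where D: "D < \<infinity>" "\<And>C. C \<in> X // E \<Longrightarrow> ext_diameter \<rho> C \<le> D"
    using ub unfolding uniformly_bounded_on_def by blast
  define c where "c = (\<lambda>x. LEAST i. x \<in> stable_part X \<rho> E r i)"
  have c: "x \<in> stable_part X \<rho> E r (c x)" "c x \<le> d" if x: "x \<in> X" for x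
  proof -
    obtain i where i: "i \<le> d" "x \<in> stable_part X \<rho> E r i" using stable_part_cover[OF em eq meets x] by blast
    show "x \<in> stable_part X \<rho> E r (c x)" unfolding c_def by (rule LeastI[of "\<lambda>i. x \<in> stable_part X \<rho> E r i", OF i(2)])
    have "c x \<le> i" unfolding c_def by (rule Least_le[of "\<lambda>i. x \<in> stable_part X \<rho> E r i", OF i(2)])
    then show "c x \<le> d" using i(1) by simp
  qed
  have bd: "chains_bounded \<rho> r (of_nat (i + 1) * r + D) (stable_part X \<rho> E r i) (\<lambda>_. 0)" for i
    by (rule stable_part_chains_bounded[OF em eq]) (rule equiv_bounded[OF eq D(2)])
  have "\<rho> x y \<le> of_nat (d + 1) * r + D" if xy: "(x, y) \<in> (step \<rho> r X c)\<^sup>+" for x y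
  proof -
    have "(x, y) \<in> (step \<rho> r (stable_part X \<rho> E r (c x)) (\<lambda>_. 0))\<^sup>+" using xy
    proof (induction rule: trancl_induct)
      case (base y)
      then show ?case using c(1)[of x] c(1)[of y] by (intro r_into_trancl) (auto simp: step_def)
    next
      case (step y z)
      have "c y = c x" using trancl_stepD[OF step.hyps(1)] by simp
      then have "(y, z) \<in> step \<rho> r (stable_part X \<rho> E r (c x)) (\<lambda>_. 0)"
        using step.hyps(2) c(1)[of y] c(1)[of z] by (auto simp: step_def)
      then show ?case using step.IH by (meson trancl.trancl_into_trancl)
    qed
    then have "\<rho> x y \<le> of_nat (c x + 1) * r + D"
      by (rule chains_boundedD[OF bd])
    also have "\<dots> \<le> of_nat (d + 1) * r + D"
      using c(2) trancl_stepD[OF xy] by (intro add_mono mult_right_mono) auto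
    finally show ?thesis .
  qed
  moreover have "of_nat (d + 1) * r + D < \<infinity>"
    using r D(1) by (simp add: ennreal_mult_less_top of_nat_less_top del: of_nat_add of_nat_Suc)
  ultimately show ?thesis using c(2) unfolding chains_bounded_def by blast
qed

section \<open>Borel colourings\<close>

lemma borel_metric_le_sets:
  assumes "(\<lambda>(x, y). \<rho> x y) \<in> borel_measurable (M \<Otimes>\<^sub>M M)"
  shows "{(x, y). x \<in> space M \<and> y \<in> space M \<and> \<rho> x y \<le> (r :: ennreal)} \<in> sets (M \<Otimes>\<^sub>M M)"
proof -
  have "{p \<in> space (M \<Otimes>\<^sub>M M). (\<lambda>(x, y). \<rho> x y) p \<le> r} \<in> sets (M \<Otimes>\<^sub>M M)"
    using assms by measurable
  also have "{p \<in> space (M \<Otimes>\<^sub>M M). (\<lambda>(x, y). \<rho> x y) p \<le> r} = {(x, y). x \<in> space M \<and> y \<in> space M \<and> \<rho> x y \<le> r}"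
    by (auto simp: space_pair_measure)
  finally show ?thesis .
qed

section \<open>Borel closure properties of relations of finite distance\<close>

text \<open>All descriptive set theory enters through two countable families: the Borel maps
  \<open>f\<close> reach every point at finite distance, and the Borel functions \<open>h\<close>
  realize every colouring of a finite set.\<close>

locale borel_proper_extended_metric =
  fixes M :: "'a measure" and \<rho> :: "'a \<Rightarrow> 'a \<Rightarrow> ennreal"
    and f :: "nat \<Rightarrow> 'a \<Rightarrow> 'a" and h :: "nat \<Rightarrow> 'a \<Rightarrow> nat"
  assumes metric: "extended_metric_on (space M) \<rho>"
    and borel_metric: "(\<lambda>(x, y). \<rho> x y) \<in> borel_measurable (M \<Otimes>\<^sub>M M)"
    and proper: "proper_on (space M) \<rho>"
    and f_measurable [measurable]: "\<And>k. f k \<in> M \<rightarrow>\<^sub>M M"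
    and f_cover: "\<And>x y. x \<in> space M \<Longrightarrow> y \<in> space M \<Longrightarrow> \<rho> x y < \<infinity> \<Longrightarrow> \<exists>k. f k x = y"
    and h_measurable [measurable]: "\<And>i. h i \<in> M \<rightarrow>\<^sub>M count_space UNIV"
    and h_interpolates: "\<And>F c. finite F \<Longrightarrow> F \<subseteq> space M \<Longrightarrow> \<exists>i. \<forall>x\<in>F. h i x = c x"
begin

lemmas metric_le_sets = borel_metric_le_sets[OF borel_metric]

lemma Domain_sets:
  assumes Q: "Q \<in> sets (M \<Otimes>\<^sub>M M)" and fin: "Q \<subseteq> fin_dist_rel (space M) \<rho>"
  shows "Domain Q \<in> sets M"
proof -
  have "Domain Q = (\<Union>k. {x \<in> space M. (x, f k x) \<in> Q})"
  proof (intro equalityI subsetI)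
    fix x assume "x \<in> Domain Q"
    then obtain y where y: "(x, y) \<in> Q" by blast
    then have "x \<in> space M" "y \<in> space M" "\<rho> x y < \<infinity>" using fin by (auto simp: fin_dist_rel_def)
    then obtain k where "f k x = y" using f_cover by blast
    then show "x \<in> (\<Union>k. {x \<in> space M. (x, f k x) \<in> Q})" using y \<open>x \<in> space M\<close> by blast
  qed auto
  also have "\<dots> \<in> sets M" using Q by measurable
  finally show ?thesis .
qed

text \<open>Finite distance is demanded of the first factor only: the middle point is then of the
  form \<open>f k x\<close>, and quantifying over it becomes a countable union.\<close>

lemma relcomp_sets:
  assumes Q: "Q \<in> sets (M \<Otimes>\<^sub>M M)" "Q' \<in> sets (M \<Otimes>\<^sub>M M)" and fin: "Q \<subseteq> fin_dist_rel (space M) \<rho>"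
  shows "Q O Q' \<in> sets (M \<Otimes>\<^sub>M M)"
proof -
  have Q'M: "Q' \<subseteq> space M \<times> space M" using sets.sets_into_space[OF Q(2)] by (simp add: space_pair_measure)
  have "Q O Q' = (\<Union>k. {p \<in> space (M \<Otimes>\<^sub>M M). (fst p, f k (fst p)) \<in> Q \<and> (f k (fst p), snd p) \<in> Q'})"
  proof (intro equalityI subsetI)
    fix p assume "p \<in> Q O Q'"
    then obtain x y z where xyz: "p = (x, z)" "(x, y) \<in> Q" "(y, z) \<in> Q'" by blast
    then have s: "x \<in> space M" "y \<in> space M" "\<rho> x y < \<infinity>" using fin by (auto simp: fin_dist_rel_def)
    then obtain k where "f k x = y" using f_cover by blast
    then have "p \<in> {p \<in> space (M \<Otimes>\<^sub>M M). (fst p, f k (fst p)) \<in> Q \<and> (f k (fst p), snd p) \<in> Q'}"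
      using xyz s Q'M by (auto simp: space_pair_measure)
    then show "p \<in> (\<Union>k. {p \<in> space (M \<Otimes>\<^sub>M M). (fst p, f k (fst p)) \<in> Q \<and> (f k (fst p), snd p) \<in> Q'})" by blast
  qed auto
  also have "\<dots> \<in> sets (M \<Otimes>\<^sub>M M)" using Q by measurable
  finally show ?thesis .
qed

lemma trancl_sets:
  assumes Q: "Q \<in> sets (M \<Otimes>\<^sub>M M)" and fin: "Q \<subseteq> fin_dist_rel (space M) \<rho>"
  shows "Q\<^sup>+ \<in> sets (M \<Otimes>\<^sub>M M)"
proof -
  have "Q ^^ Suc n \<in> sets (M \<Otimes>\<^sub>M M)" for n
  proof (induction n)
    case (Suc n)
    \<comment> \<open>The power is unfolded on the left so that the factor of finite-distance pairs
      stands first, as \<open>relcomp_sets\<close> demands.\<close>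
    have "Q ^^ Suc (Suc n) = Q O Q ^^ Suc n" by (rule relpow_commute[symmetric, THEN trans[OF relpow.simps(2)]])
    then show ?case using relcomp_sets[OF Q Suc fin] by simp
  qed (simp add: Q)
  then have "(\<Union>n. Q ^^ Suc n) \<in> sets (M \<Otimes>\<^sub>M M)" by blast
  moreover have "Q\<^sup>+ = (\<Union>n. Q ^^ Suc n)"
    unfolding trancl_power set_eq_iff by (auto simp: trancl_power simp del: relpow.simps) (metis Suc_pred)
  ultimately show ?thesis by simp
qed

lemma step_subset_fin_dist_rel:
  assumes "Y \<subseteq> space M" "r < \<infinity>" shows "step \<rho> r Y c \<subseteq> fin_dist_rel (space M) \<rho>"
  using assms by (auto simp: step_def fin_dist_rel_def intro: le_less_trans)

lemma fin_dist_rel_trans: "trans (fin_dist_rel (space M) \<rho>)"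
proof (rule transI)
  fix x y z assume "(x, y) \<in> fin_dist_rel (space M) \<rho>" "(y, z) \<in> fin_dist_rel (space M) \<rho>"
  then have a: "x \<in> space M" "y \<in> space M" "z \<in> space M" "\<rho> x y < \<infinity>" "\<rho> y z < \<infinity>"
    by (auto simp: fin_dist_rel_def)
  have "\<rho> x z \<le> \<rho> x y + \<rho> y z" by (rule extended_metric_onD(3)[OF metric a(1-3)])
  also have "\<dots> < \<infinity>" using a by simp
  finally show "(x, z) \<in> fin_dist_rel (space M) \<rho>" using a by (auto simp: fin_dist_rel_def)
qed

lemma trancl_step_subset_fin_dist_rel:
  assumes "Y \<subseteq> space M" "r < \<infinity>" shows "(step \<rho> r Y c)\<^sup>+ \<subseteq> fin_dist_rel (space M) \<rho>"
proof (rule subrelI)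
  fix x y assume "(x, y) \<in> (step \<rho> r Y c)\<^sup>+"
  then show "(x, y) \<in> fin_dist_rel (space M) \<rho>"
  proof (induction rule: trancl_induct)
    case (base y) then show ?case using step_subset_fin_dist_rel[OF assms] by blast
  next
    case (step y z) then show ?case using step_subset_fin_dist_rel[OF assms] fin_dist_rel_trans
      by (meson subsetD transD)
  qed
qed

lemma step_sets:
  assumes Y: "Y \<in> sets M" and c: "c \<in> M \<rightarrow>\<^sub>M count_space UNIV"
  shows "step \<rho> r Y c \<in> sets (M \<Otimes>\<^sub>M M)"
proof -
  have [measurable]: "Measurable.pred (M \<Otimes>\<^sub>M M) (\<lambda>p. c (fst p) = c (snd p))"
  proof -
    note c[measurable]
    show ?thesis by (intro pred_eq_countable) measurable
  qed
  have "step \<rho> r Y c = {(x, y). x \<in> space M \<and> y \<in> space M \<and> \<rho> x y \<le> r} \<inter>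
      {p \<in> space (M \<Otimes>\<^sub>M M). fst p \<in> Y \<and> snd p \<in> Y \<and> c (fst p) = c (snd p)}"
    using sets.sets_into_space[OF Y] by (auto simp: step_def space_pair_measure)
  also have "\<dots> \<in> sets (M \<Otimes>\<^sub>M M)"
  proof (rule sets.Int[OF metric_le_sets])
    show "{p \<in> space (M \<Otimes>\<^sub>M M). fst p \<in> Y \<and> snd p \<in> Y \<and> c (fst p) = c (snd p)} \<in> sets (M \<Otimes>\<^sub>M M)"
      using Y by measurable
  qed
  finally show ?thesis .
qed

lemma trancl_step_sets:
  assumes "Y \<in> sets M" "c \<in> M \<rightarrow>\<^sub>M count_space UNIV" "r < \<infinity>"
  shows "(step \<rho> r Y c)\<^sup>+ \<in> sets (M \<Otimes>\<^sub>M M)"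
  by (intro trancl_sets step_sets step_subset_fin_dist_rel assms sets.sets_into_space[OF assms(1)])

lemma stable_part_sets:
  assumes E: "E \<in> sets (M \<Otimes>\<^sub>M M)" and r: "r < \<infinity>"
  shows "stable_part (space M) \<rho> E r i \<in> sets M"
proof -
  have fin: "{(x, y). x \<in> space M \<and> y \<in> space M \<and> \<rho> x y \<le> of_nat n * r} \<subseteq> fin_dist_rel (space M) \<rho>" for n
  proof -
    have "of_nat n * r < \<infinity>" using r by (simp add: ennreal_mult_less_top of_nat_less_top)
    then show ?thesis by (auto simp: fin_dist_rel_def intro: le_less_trans)
  qed
  have "neighbours (space M) \<rho> E (of_nat (i + 1) * r) \<in> sets (M \<Otimes>\<^sub>M M)"
    unfolding neighbours_def by (intro relcomp_sets metric_le_sets E fin)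
  then have "Domain ({(x, y). x \<in> space M \<and> y \<in> space M \<and> \<rho> x y \<le> of_nat (i + 2) * r} -
     neighbours (space M) \<rho> E (of_nat (i + 1) * r)) \<in> sets M"
    by (intro Domain_sets sets.Diff metric_le_sets order_trans[OF Diff_subset fin])
  then show ?thesis unfolding stable_part_def by blast
qed

text \<open>On each \<open>R\<close>-component of \<open>Y\<close>, which is finite, use the first \<open>h i\<close> that is as good as the given
  (arbitrary) colouring.\<close>

lemma borel_colouring_of_bounded_components:
  assumes Y: "Y \<in> sets M" and R: "R < \<infinity>" "s \<le> R" and comp: "chains_bounded \<rho> R D' Y (\<lambda>_. 0)" "D' < \<infinity>"
    and c': "\<And>x. x \<in> space M \<Longrightarrow> c' x \<le> d" "chains_bounded \<rho> s D (space M) c'"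
  shows "\<exists>c. c \<in> M \<rightarrow>\<^sub>M count_space UNIV \<and> (\<forall>x. c x \<le> d) \<and> chains_bounded \<rho> s D Y c"
proof -
  have YM: "Y \<subseteq> space M" by (rule sets.sets_into_space[OF Y])
  have s: "s < \<infinity>" using R by (rule le_less_trans[rotated])
  define K where "K = (step \<rho> R Y (\<lambda>_. 0))\<^sup>+"
  have K: "K \<in> sets (M \<Otimes>\<^sub>M M)" "K \<subseteq> fin_dist_rel (space M) \<rho>" "trans K" "sym K"
    unfolding K_def by (rule trancl_step_sets[OF Y _ R(1)], simp) (rule trancl_step_subset_fin_dist_rel[OF YM R(1)],
      rule trans_trancl, rule sym_trancl[OF sym_step[OF metric YM]])
  \<comment> \<open>Composing with \<open>K\<close> spreads a failure over the whole
    \<open>R\<close>-component: an overlong monochromatic chain, or a colour above \<open>d\<close>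
    at its start. The choice \<open>N\<close> is therefore constant on components.\<close>
  define bad where "bad = (\<lambda>i. K O ((step \<rho> s Y (h i))\<^sup>+ \<inter>
     {p \<in> space (M \<Otimes>\<^sub>M M). \<not> (\<lambda>(x, y). \<rho> x y) p \<le> D \<or> \<not> h i (fst p) \<le> d}))"
  have bad_iff: "x \<in> Domain (bad i) \<longleftrightarrow>
     (\<exists>y z. (x, y) \<in> K \<and> (y, z) \<in> (step \<rho> s Y (h i))\<^sup>+ \<and> (\<not> \<rho> y z \<le> D \<or> \<not> h i y \<le> d))" for x i
  proof -
    have "y \<in> space M \<and> z \<in> space M" if "(y, z) \<in> (step \<rho> s Y (h i))\<^sup>+" for y z
      using trancl_stepD[OF that] YM by blast
    then show ?thesis unfolding bad_def by (auto simp: space_pair_measure Domain_iff relcomp_unfold)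
  qed
  have bad: "Domain (bad i) \<in> sets M" for i
  proof (rule Domain_sets)
    have "(step \<rho> s Y (h i))\<^sup>+ \<inter> {p \<in> space (M \<Otimes>\<^sub>M M). \<not> (\<lambda>(x, y). \<rho> x y) p \<le> D \<or> \<not> h i (fst p) \<le> d} \<in> sets (M \<Otimes>\<^sub>M M)"
    proof (intro sets.Int trancl_step_sets Y s h_measurable)
      note borel_metric[measurable]
      show "{p \<in> space (M \<Otimes>\<^sub>M M). \<not> (\<lambda>(x, y). \<rho> x y) p \<le> D \<or> \<not> h i (fst p) \<le> d} \<in> sets (M \<Otimes>\<^sub>M M)"
        by measurable
    qed
    then show "bad i \<in> sets (M \<Otimes>\<^sub>M M)" unfolding bad_def by (intro relcomp_sets K)
    show "bad i \<subseteq> fin_dist_rel (space M) \<rho>"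
    proof (rule subrelI)
      fix x z assume "(x, z) \<in> bad i"
      then obtain y where "(x, y) \<in> K" "(y, z) \<in> (step \<rho> s Y (h i))\<^sup>+" unfolding bad_def by blast
      then show "(x, z) \<in> fin_dist_rel (space M) \<rho>"
        using K(2) trancl_step_subset_fin_dist_rel[OF YM s] by (meson fin_dist_rel_trans subsetD transD)
    qed
  qed
  define N where "N = (\<lambda>x. LEAST i. x \<notin> Domain (bad i))"
  have N: "N \<in> M \<rightarrow>\<^sub>M count_space UNIV"
  proof -
    note bad[measurable]
    show ?thesis unfolding N_def by measurable
  qed
  \<comment> \<open>The default 0 keeps the colours at most \<open>d\<close> off \<open>Y\<close> as
    well.\<close>
  define c where "c = (\<lambda>x. if x \<in> Y - Domain (bad (N x)) then h (N x) x else 0)"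
  \<comment> \<open>The component of \<open>x\<close> is finite by properness, so some
    \<open>h i\<close> agrees with \<open>c'\<close> on it. As \<open>s \<le> R\<close>, an
    \<open>s\<close>-chain starting in the component stays there and is an \<open>s\<close>-chain
    for \<open>c'\<close>.\<close>
  have good: "\<exists>i. x \<notin> Domain (bad i)" if x: "x \<in> Y" for x
  proof -
    have xM: "x \<in> space M" using x YM by blast
    have KX: "K `` {x} \<subseteq> ext_cball (space M) \<rho> x D'"
    proof
      fix y assume "y \<in> K `` {x}"
      then have "(x, y) \<in> (step \<rho> R Y (\<lambda>_. 0))\<^sup>+" by (simp add: K_def)
      then show "y \<in> ext_cball (space M) \<rho> x D'"
        using chains_boundedD[OF comp(1)] trancl_stepD[of x y \<rho> R Y "\<lambda>_. 0"] YM by (auto simp: ext_cball_def)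
    qed
    then have "finite (K `` {x})" using proper xM comp(2) unfolding proper_on_def by (meson finite_subset)
    moreover have "K `` {x} \<subseteq> space M" using KX by (auto simp: ext_cball_def)
    ultimately obtain i where i: "\<And>y. (x, y) \<in> K \<Longrightarrow> h i y = c' y" using h_interpolates[of "K `` {x}" c'] by blast
    have "(x, z) \<in> K \<and> (y, z) \<in> (step \<rho> s (space M) c')\<^sup>+" if yz: "(y, z) \<in> (step \<rho> s Y (h i))\<^sup>+" and xy: "(x, y) \<in> K" for y z
      using yz
    proof (induction rule: trancl_induct)
      case (base z)
      have "(y, z) \<in> step \<rho> R Y (\<lambda>_. 0)" using stepD[OF base] R(2) by (auto intro: stepI order_trans)
      then have "(x, z) \<in> K" using xy unfolding K_def by (meson trancl.trancl_into_trancl)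
      then show ?case using stepD[OF base] i xy YM by (auto intro!: r_into_trancl stepI)
    next
      case (step z w)
      have "(z, w) \<in> step \<rho> R Y (\<lambda>_. 0)" using stepD[OF step.hyps(2)] R(2) by (auto intro: stepI order_trans)
      then have xw: "(x, w) \<in> K" using step.IH unfolding K_def by (meson trancl.trancl_into_trancl)
      have "(z, w) \<in> step \<rho> s (space M) c'"
        using stepD[OF step.hyps(2)] i[OF xw] i[of z] step.IH YM by (intro stepI) auto
      then show ?case using xw step.IH by (meson trancl.trancl_into_trancl)
    qed
    moreover have "h i y \<le> d" if "(x, y) \<in> K" for y
      using i[OF that] c'(1)[of y] that K(2) by (auto simp: fin_dist_rel_def)
    ultimately have "x \<notin> Domain (bad i)" unfolding bad_iff using chains_boundedD[OF c'(2)] by blast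
    then show ?thesis by blast
  qed
  have goodN: "x \<notin> Domain (bad (N x))" if "x \<in> Y" for x
    unfolding N_def by (rule LeastI_ex[OF good[OF that]])
  have KN: "N x = N y" if "(x, y) \<in> K" for x y
  proof -
    have "x \<in> Domain (bad i) \<longleftrightarrow> y \<in> Domain (bad i)" for i
      unfolding bad_iff using that K(3,4) by (meson symD transD)
    then show ?thesis by (simp add: N_def)
  qed
  have Kx: "(x, x) \<in> K" if "x \<in> Y" for x
    unfolding K_def by (intro r_into_trancl step_refl[OF metric YM that])
  have cY: "c x = h (N x) x" "h (N x) x \<le> d" if "x \<in> Y" for x
  proof -
    show "c x = h (N x) x" using that goodN by (simp add: c_def)
    have "(x, x) \<in> (step \<rho> s Y (h (N x)))\<^sup>+" by (intro r_into_trancl step_refl[OF metric YM that])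
    then show "h (N x) x \<le> d" using goodN[OF that] Kx[OF that] unfolding bad_iff by blast
  qed
  have hN: "(\<lambda>x. h (N x) x) \<in> M \<rightarrow>\<^sub>M count_space UNIV"
    by (rule measurable_compose_countable[OF h_measurable N])
  have "c = (\<lambda>x. if x \<in> Y then h (N x) x else 0)" using cY by (auto simp: c_def)
  moreover have "(\<lambda>x. if x \<in> Y then h (N x) x else 0) \<in> M \<rightarrow>\<^sub>M count_space UNIV"
    by (rule measurable_If_set) (use hN Y in auto)
  ultimately have "c \<in> M \<rightarrow>\<^sub>M count_space UNIV" by simp
  moreover have "c x \<le> d" for x using cY by (cases "x \<in> Y") (auto simp: c_def)
  moreover have "\<rho> x y \<le> D" if xy: "(x, y) \<in> (step \<rho> s Y c)\<^sup>+" for x y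
  proof -
    have xY: "x \<in> Y" using trancl_stepD[OF xy] by blast
    \<comment> \<open>An \<open>s\<close>-chain stays in one \<open>R\<close>-component, where
      \<open>c\<close> is the single function \<open>h (N x)\<close>.\<close>
    have "(x, y) \<in> (step \<rho> s Y (h (N x)))\<^sup>+ \<and> N y = N x" using xy
    proof (induction rule: trancl_induct)
      case (base y)
      note b = stepD[OF base]
      have "(x, y) \<in> K" unfolding K_def using b R(2) by (auto intro!: r_into_trancl stepI intro: order_trans)
      then have "N y = N x" using KN by simp
      then show ?case using b cY by (auto intro!: r_into_trancl stepI)
    next
      case (step y z)
      note b = stepD[OF step.hyps(2)]
      have "(y, z) \<in> K" unfolding K_def using b R(2) by (auto intro!: r_into_trancl stepI intro: order_trans)
      then have "N z = N x" using KN step.IH by simp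
      then have "(y, z) \<in> step \<rho> s Y (h (N x))" using b cY[of y] cY[of z] step.IH by (auto intro!: stepI)
      then show ?case using step.IH \<open>N z = N x\<close> by (meson trancl.trancl_into_trancl)
    qed
    then show ?thesis using goodN[OF xY] Kx[OF xY] unfolding bad_iff by blast
  qed
  ultimately show ?thesis unfolding chains_bounded_def by blast
qed

text \<open>The order of quantifiers is the point: \<open>R\<close> and \<open>D\<close> are chosen
  before the sets \<open>Y i\<close>, and the component bounds \<open>D'\<close> may depend on the
  sets without affecting \<open>D\<close>.\<close>

lemma borel_colouring_of_finite_union:
  fixes n :: nat
  assumes col: "\<And>s. 0 < s \<Longrightarrow> s < \<infinity> \<Longrightarrow> \<exists>D<\<infinity>. \<exists>c. (\<forall>x\<in>space M. c x \<le> d) \<and> chains_bounded \<rho> s D (space M) c"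
    and r: "0 < r" "r < \<infinity>"
  shows "\<exists>R D. 0 < R \<and> R < \<infinity> \<and> D < \<infinity> \<and> (\<forall>Y. (\<forall>i\<le>n. Y i \<in> sets M \<and> (\<exists>D'<\<infinity>. chains_bounded \<rho> R D' (Y i) (\<lambda>_. 0)))
     \<longrightarrow> (\<exists>c. c \<in> M \<rightarrow>\<^sub>M count_space UNIV \<and> (\<forall>x. c x \<le> d) \<and> chains_bounded \<rho> r D (\<Union>i\<le>n. Y i) c))"
proof (induction n)
  case 0
  obtain D c where D: "D < \<infinity>" "\<And>x. x \<in> space M \<Longrightarrow> c x \<le> d" "chains_bounded \<rho> r D (space M) c"
    using col[OF r] by blast
  have "\<exists>c. c \<in> M \<rightarrow>\<^sub>M count_space UNIV \<and> (\<forall>x. c x \<le> d) \<and> chains_bounded \<rho> r D (\<Union>i\<le>0. Y i) c"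
    if Y: "\<forall>i\<le>0. Y i \<in> sets M \<and> (\<exists>D'<\<infinity>. chains_bounded \<rho> r D' (Y i) (\<lambda>_. 0))" for Y :: "nat \<Rightarrow> 'a set"
  proof -
    obtain D' where "Y 0 \<in> sets M" "D' < \<infinity>" "chains_bounded \<rho> r D' (Y 0) (\<lambda>_. 0)" using Y by auto
    then show ?thesis using borel_colouring_of_bounded_components[OF _ r(2) order_refl _ _ D(2,3)] by simp
  qed
  then show ?case using r D(1) by blast
next
  case (Suc n)
  then obtain R1 D1 where RD: "0 < R1" "R1 < \<infinity>" "D1 < \<infinity>"
    and IH: "\<And>Y. \<forall>i\<le>n. Y i \<in> sets M \<and> (\<exists>D'<\<infinity>. chains_bounded \<rho> R1 D' (Y i) (\<lambda>_. 0)) \<Longrightarrow>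
      \<exists>c. c \<in> M \<rightarrow>\<^sub>M count_space UNIV \<and> (\<forall>x. c x \<le> d) \<and> chains_bounded \<rho> r D1 (\<Union>i\<le>n. Y i) c"
    by blast
  \<comment> \<open>The new set has to be coloured at the mesh at which
    \<open>chains_bounded_Un\<close> sees chains jump over excursions into the earlier sets.\<close>
  define t where "t = r + (D1 + r)"
  have t: "0 < t" "t < \<infinity>" using r RD by (auto simp: t_def zero_less_iff_neq_zero)
  obtain D2 c' where D2: "D2 < \<infinity>" "\<And>x. x \<in> space M \<Longrightarrow> c' x \<le> d" "chains_bounded \<rho> t D2 (space M) c'"
    using col[OF t] by blast
  \<comment> \<open>Sets with bounded \<open>R\<close>-components also have bounded components at
    every smaller scale, so one \<open>R\<close> serves the earlier sets and the new one.\<close>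
  define R where "R = max R1 t"
  have R: "0 < R" "R < \<infinity>" "t \<le> R" "R1 \<le> R" using RD t by (auto simp: R_def max_def)
  define D where "D = (D1 + r) + (D2 + (r + D1))"
  have "D < \<infinity>" using RD D2 r by (auto simp: D_def)
  have "\<exists>c. c \<in> M \<rightarrow>\<^sub>M count_space UNIV \<and> (\<forall>x. c x \<le> d) \<and> chains_bounded \<rho> r D (\<Union>i\<le>Suc n. Y i) c"
    if Y: "\<forall>i\<le>Suc n. Y i \<in> sets M \<and> (\<exists>D'<\<infinity>. chains_bounded \<rho> R D' (Y i) (\<lambda>_. 0))" for Y :: "nat \<Rightarrow> 'a set"
  proof -
    have "\<forall>i\<le>n. Y i \<in> sets M \<and> (\<exists>D'<\<infinity>. chains_bounded \<rho> R1 D' (Y i) (\<lambda>_. 0))"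
      using Y chains_bounded_mono[OF _ R(4) order_refl] by (meson le_SucI)
    from IH[OF this] obtain c1 where c1: "c1 \<in> M \<rightarrow>\<^sub>M count_space UNIV" "\<And>x. c1 x \<le> d"
      "chains_bounded \<rho> r D1 (\<Union>i\<le>n. Y i) c1" by blast
    obtain D' where D': "Y (Suc n) \<in> sets M" "D' < \<infinity>" "chains_bounded \<rho> R D' (Y (Suc n)) (\<lambda>_. 0)" using Y by auto
    obtain c2 where c2: "c2 \<in> M \<rightarrow>\<^sub>M count_space UNIV" "\<And>x. c2 x \<le> d" "chains_bounded \<rho> t D2 (Y (Suc n)) c2"
      using borel_colouring_of_bounded_components[OF D'(1) R(2,3) D'(3,2) D2(2,3)] by blast
    define c where "c = (\<lambda>x. if x \<in> Y (Suc n) then c2 x else c1 x)"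
    have YM: "Y i \<subseteq> space M" if "i \<le> Suc n" for i using Y that by (meson sets.sets_into_space)
    have "(\<Union>i\<le>n. Y i) \<subseteq> space M" by (intro UN_least YM) simp
    then have "chains_bounded \<rho> r D ((\<Union>i\<le>n. Y i) \<union> Y (Suc n)) c"
      unfolding c_def D_def by (intro chains_bounded_Un[OF metric _ YM c1(3) c2(3)[unfolded t_def]]) auto
    moreover have "(\<Union>i\<le>n. Y i) \<union> Y (Suc n) = (\<Union>i\<le>Suc n. Y i)" by (auto simp: atMost_Suc)
    moreover have "c \<in> M \<rightarrow>\<^sub>M count_space UNIV" unfolding c_def using c1(1) c2(1) D'(1) by measurable
    moreover have "c x \<le> d" for x using c1(2) c2(2) by (simp add: c_def)
    ultimately show ?thesis by metis
  qed
  then show ?case using R(1,2) \<open>D < \<infinity>\<close> by blast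
qed

lemma borel_asdim_witness:
  assumes asd: "\<And>r. 0 < r \<Longrightarrow> r < \<infinity> \<Longrightarrow> \<exists>E. equiv (space M) E \<and> uniformly_bounded_on (space M) \<rho> E \<and>
      ball_meets_at_most (space M) \<rho> E r (d + 1)"
    and bor: "\<And>r. 0 < r \<Longrightarrow> r < \<infinity> \<Longrightarrow> \<exists>E. equiv (space M) E \<and> E \<in> sets (M \<Otimes>\<^sub>M M) \<and>
      uniformly_bounded_on (space M) \<rho> E \<and> ball_meets_at_most (space M) \<rho> E r (m + 1)"
    and r: "0 < r" "r < \<infinity>"
  shows "\<exists>E. equiv (space M) E \<and> E \<in> sets (M \<Otimes>\<^sub>M M) \<and>
      uniformly_bounded_on (space M) \<rho> E \<and> ball_meets_at_most (space M) \<rho> E r (d + 1)"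
proof -
  have scale: "0 < of_nat (n + 2) * s" "of_nat (n + 2) * s < \<infinity>" if "0 < s" "s < \<infinity>" for n and s :: ennreal
    using that by (auto simp: ennreal_zero_less_mult_iff ennreal_mult_less_top of_nat_less_top zero_less_iff_neq_zero)
  have col: "\<exists>D<\<infinity>. \<exists>c. (\<forall>x\<in>space M. c x \<le> d) \<and> chains_bounded \<rho> s D (space M) c"
    if s: "0 < s" "s < \<infinity>" for s
  proof -
    obtain E where "equiv (space M) E" "uniformly_bounded_on (space M) \<rho> E"
      "ball_meets_at_most (space M) \<rho> E (of_nat (d + 2) * s) (d + 1)"
      using asd[OF scale[OF s]] by blast
    then show ?thesis by (rule chains_bounded_colouring_exists[OF metric s(2)])
  qed
  \<comment> \<open>The scale \<open>2 * r\<close> is the one at which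
    \<open>trancl_step_ball_meets\<close> controls balls of radius \<open>r\<close>.\<close>
  have r2: "0 < 2 * r" "2 * r < \<infinity>" using scale[OF r, of 0] by simp_all
  obtain R D where RD: "0 < R" "R < \<infinity>" "D < \<infinity>"
    and ex: "\<And>Y. \<forall>i\<le>m. Y i \<in> sets M \<and> (\<exists>D'<\<infinity>. chains_bounded \<rho> R D' (Y i) (\<lambda>_. 0)) \<Longrightarrow>
      \<exists>c. c \<in> M \<rightarrow>\<^sub>M count_space UNIV \<and> (\<forall>x. c x \<le> d) \<and> chains_bounded \<rho> (2 * r) D (\<Union>i\<le>m. Y i) c"
    using borel_colouring_of_finite_union[OF col r2, of m] by blast
  \<comment> \<open>Only now is the Borel relation taken: at radius \<open>(m + 2) * R\<close> its
    first \<open>m + 1\<close> stable parts cover the space, and they have bounded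
    \<open>R\<close>-components.\<close>
  obtain E where E: "equiv (space M) E" "E \<in> sets (M \<Otimes>\<^sub>M M)" "uniformly_bounded_on (space M) \<rho> E"
      "ball_meets_at_most (space M) \<rho> E (of_nat (m + 2) * R) (m + 1)"
    using bor[OF scale[OF RD(1,2)]] by blast
  obtain D1 where D1: "D1 < \<infinity>" "\<And>C. C \<in> space M // E \<Longrightarrow> ext_diameter \<rho> C \<le> D1"
    using E(3) unfolding uniformly_bounded_on_def by blast
  let ?Y = "stable_part (space M) \<rho> E R"
  have "?Y i \<in> sets M \<and> (\<exists>D'<\<infinity>. chains_bounded \<rho> R D' (?Y i) (\<lambda>_. 0))" for i
  proof (intro conjI exI)
    show "?Y i \<in> sets M" by (rule stable_part_sets[OF E(2) RD(2)])
    show "of_nat (i + 1) * R + D1 < \<infinity>"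
      using RD(2) D1(1) by (simp add: ennreal_mult_less_top of_nat_less_top del: of_nat_add of_nat_Suc)
    show "chains_bounded \<rho> R (of_nat (i + 1) * R + D1) (?Y i) (\<lambda>_. 0)"
      by (rule stable_part_chains_bounded[OF metric E(1)]) (rule equiv_bounded[OF E(1) D1(2)])
  qed
  then obtain c where c: "c \<in> M \<rightarrow>\<^sub>M count_space UNIV" "\<And>x. c x \<le> d" "chains_bounded \<rho> (2 * r) D (\<Union>i\<le>m. ?Y i) c"
    using ex[of ?Y] by blast
  have "(\<Union>i\<le>m. ?Y i) = space M"
  proof
    show "(\<Union>i\<le>m. ?Y i) \<subseteq> space M" by (auto simp: stable_part_def)
    show "space M \<subseteq> (\<Union>i\<le>m. ?Y i)"
    proof
      fix x assume "x \<in> space M"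
      from stable_part_cover[OF metric E(1,4) this] show "x \<in> (\<Union>i\<le>m. ?Y i)" by blast
    qed
  qed
  then have b: "chains_bounded \<rho> (2 * r) D (space M) c" using c(3) by simp
  show ?thesis
  proof (intro exI conjI)
    show "equiv (space M) ((step \<rho> (2 * r) (space M) c)\<^sup>+)" by (rule equiv_trancl_step[OF metric])
    show "(step \<rho> (2 * r) (space M) c)\<^sup>+ \<in> sets (M \<Otimes>\<^sub>M M)" by (rule trancl_step_sets[OF sets.top c(1) r2(2)])
    show "uniformly_bounded_on (space M) \<rho> ((step \<rho> (2 * r) (space M) c)\<^sup>+)"
      by (rule trancl_step_uniformly_bounded[OF metric b RD(3)])
    show "ball_meets_at_most (space M) \<rho> ((step \<rho> (2 * r) (space M) c)\<^sup>+) r (d + 1)"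
      by (rule trancl_step_ball_meets[OF metric c(2)])
  qed
qed

end

section \<open>Construction of the countable families and the equality of dimensions\<close>

lemma borel_proper_extended_metric_exists:
  assumes sb: "standard_borel_space M" "space M \<noteq> {}" and metric: "extended_metric_on (space M) \<rho>"
    and meas: "(\<lambda>(x, y). \<rho> x y) \<in> borel_measurable (M \<Otimes>\<^sub>M M)" and proper: "proper_on (space M) \<rho>"
  shows "\<exists>f h. borel_proper_extended_metric M \<rho> f h"
proof -
  obtain g L where ret: "baire_retract M g L" using standard_borel_space_baire_retract[OF sb] by blast
  \<comment> \<open>Sections of the finite-distance relation may be infinite, but it is a countable
    union of these relations, whose sections are balls and so finite.\<close>
  define P where "P = (\<lambda>n::nat. {(x, y). x \<in> space M \<and> y \<in> space M \<and> \<rho> x y \<le> of_nat n})"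
  have "finite {y. (x, y) \<in> P n}" for x n
  proof (cases "x \<in> space M")
    case True
    then have "finite (ext_cball (space M) \<rho> x (of_nat n))"
      using proper by (simp add: proper_on_def of_nat_less_top)
    then show ?thesis by (rule finite_subset[rotated]) (auto simp: P_def ext_cball_def)
  qed (simp add: P_def)
  then have "\<exists>f :: nat \<Rightarrow> 'a \<Rightarrow> 'a. (\<forall>k. f k \<in> M \<rightarrow>\<^sub>M M) \<and> (\<forall>(x, y)\<in>P n. \<exists>k. f k x = y)" for n
    using finite_sections_uniformization[OF ret ret, of "P n"] borel_metric_le_sets[OF meas] by (simp add: P_def)
  then have "\<forall>n. \<exists>f :: nat \<Rightarrow> 'a \<Rightarrow> 'a. (\<forall>k. f k \<in> M \<rightarrow>\<^sub>M M) \<and> (\<forall>(x, y)\<in>P n. \<exists>k. f k x = y)" ..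
  from choice[OF this] obtain F :: "nat \<Rightarrow> nat \<Rightarrow> 'a \<Rightarrow> 'a"
    where F: "\<forall>n. (\<forall>k. F n k \<in> M \<rightarrow>\<^sub>M M) \<and> (\<forall>(x, y)\<in>P n. \<exists>k. F n k x = y)" ..
  define f where "f = (\<lambda>k. case prod_decode k of (n, j) \<Rightarrow> F n j)"
  have "inj_on g (space M)" using ret by (intro inj_on_inverseI[of _ L]) (simp add: baire_retract_def)
  moreover have "g \<in> borel_measurable M" using ret by (simp add: baire_retract_def)
  ultimately obtain h :: "nat \<Rightarrow> 'a \<Rightarrow> nat" where h: "\<And>i. h i \<in> M \<rightarrow>\<^sub>M count_space UNIV"
      "\<And>S c. finite S \<Longrightarrow> S \<subseteq> space M \<Longrightarrow> \<exists>i. \<forall>x\<in>S. h i x = c x"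
    using measurable_finite_interpolation[of g M] by metis
  have "borel_proper_extended_metric M \<rho> f h"
  proof
    show "f k \<in> M \<rightarrow>\<^sub>M M" for k using F by (simp add: f_def split: prod.split)
    fix x y assume xy: "x \<in> space M" "y \<in> space M" "\<rho> x y < \<infinity>"
    then obtain n :: nat where "\<rho> x y < of_nat n" using ennreal_Ex_less_of_nat[of "\<rho> x y"] by auto
    then have "(x, y) \<in> P n" using xy by (simp add: P_def)
    then obtain j where "F n j x = y" using spec[OF F, of n] by auto
    then have "f (prod_encode (n, j)) x = y" by (simp add: f_def)
    then show "\<exists>k. f k x = y" by blast
  qed (fact metric meas proper h)+
  then show ?thesis by blast
qed

theorem theorem1p1:
  fixes X :: "'a measure" and \<rho> :: "'a \<Rightarrow> 'a \<Rightarrow> ennreal"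
  assumes "standard_borel_space X"
    and "extended_metric_on (space X) \<rho>"
    and "(\<lambda>(x, y). \<rho> x y) \<in> borel_measurable (X \<Otimes>\<^sub>M X)"
    and "proper_on (space X) \<rho>"
    and "borel_asdim X \<rho> < \<infinity>"
  shows "borel_asdim X \<rho> = asdim (space X) \<rho>"
proof -
  define B where "B = (\<lambda>d r. \<exists>E. equiv (space X) E \<and> E \<in> sets (X \<Otimes>\<^sub>M X) \<and>
      uniformly_bounded_on (space X) \<rho> E \<and> ball_meets_at_most (space X) \<rho> E r (d + 1))"
  define A where "A = (\<lambda>d r. \<exists>E. equiv (space X) E \<and>
      uniformly_bounded_on (space X) \<rho> E \<and> ball_meets_at_most (space X) \<rho> E r (d + 1))"
  have dims: "borel_asdim X \<rho> = Inf {enat d | d. \<forall>r. 0 < r \<and> r < \<infinity> \<longrightarrow> B d r}"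
      "asdim (space X) \<rho> = Inf {enat d | d. \<forall>r. 0 < r \<and> r < \<infinity> \<longrightarrow> A d r}"
    by (simp_all add: borel_asdim_def asdim_def A_def B_def)
  have "{enat d | d. \<forall>r. 0 < r \<and> r < \<infinity> \<longrightarrow> B d r} \<noteq> {}"
  proof
    assume "{enat d | d. \<forall>r. 0 < r \<and> r < \<infinity> \<longrightarrow> B d r} = {}"
    then have "borel_asdim X \<rho> = \<infinity>" unfolding dims by (simp only: Inf_empty top_enat_def)
    then show False using assms(5) by simp
  qed
  then obtain m where m: "\<And>r. 0 < r \<Longrightarrow> r < \<infinity> \<Longrightarrow> B m r" by blast
  have BA: "B d r" if hA: "\<And>r. 0 < r \<Longrightarrow> r < \<infinity> \<Longrightarrow> A d r" and r: "0 < r" "r < \<infinity>" for d r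
  \<comment> \<open>The coding by Baire space needs a point to serve as default value; on the empty
    space the only relation is \<open>{}\<close>, which is Borel.\<close>
  proof (cases "space X = {}")
    case True
    obtain E where E: "equiv (space X) E" "uniformly_bounded_on (space X) \<rho> E"
        "ball_meets_at_most (space X) \<rho> E r (d + 1)"
      using hA[OF r] unfolding A_def by blast
    moreover have "E = {}" using equiv_type[OF E(1)] True by auto
    ultimately show ?thesis unfolding B_def by blast
  next
    case False
    obtain f h where "borel_proper_extended_metric X \<rho> f h"
      using borel_proper_extended_metric_exists[OF assms(1) False assms(2-4)] by blast
    then interpret borel_proper_extended_metric X \<rho> f h .
    show ?thesis unfolding B_def
      by (rule borel_asdim_witness[OF hA[unfolded A_def] m[unfolded B_def] r])
  qed
  \<comment> \<open>The same \<open>d\<close> are admissible for both dimensions, so the infima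
    agree. The value \<open>m\<close> only has to be some finite bound.\<close>
  have "(\<forall>r. 0 < r \<and> r < \<infinity> \<longrightarrow> B d r) \<longleftrightarrow> (\<forall>r. 0 < r \<and> r < \<infinity> \<longrightarrow> A d r)" for d
  proof
    assume "\<forall>r. 0 < r \<and> r < \<infinity> \<longrightarrow> B d r"
    then show "\<forall>r. 0 < r \<and> r < \<infinity> \<longrightarrow> A d r" unfolding A_def B_def by blast
  next
    assume "\<forall>r. 0 < r \<and> r < \<infinity> \<longrightarrow> A d r"
    then show "\<forall>r. 0 < r \<and> r < \<infinity> \<longrightarrow> B d r" using BA by blast
  qed
  then show ?thesis unfolding dims by simp
qed

end
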